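(* Let $\mathcal{G}=(\mathcal{V},\mathcal{E})$ be a digraph on $n>1$ nodes, and fix activation probabilities $p_{ij}$ and updating weights $w_{ij}$ as in the context. Then $\mathcal{G}$ is strongly connected if and only if there exists $\bar\epsilon>0$ such that for every $\epsilon\in(0,\bar\epsilon)$ the gossip algorithm with parameter $\epsilon$ achieves almost sure average consensus.
   Context: Setting: $\mathcal{V}=\{1,\dots,n\}$, $n>1$, and $\mathcal{G}$ has no selfloops. An edge $(j,i)$ means that $j$ sends to $i$. To each edge $(j,i)\in\mathcal{E}$ are assigned a probability $p_{ij}\in(0,1)$, with $\sum_{(j,i)\in\mathcal{E}}p_{ij}=1$, and an updating weight $w_{ij}\in(0,1)$. Gossip algorithm with parameter $\epsilon>0$: at each time $k\in\mathbb{Z}_+$, exactly one edge is activated. The choice is independent of the past, and edge $(j,i)$ is activated with probability $p_{ij}$. If $(j,i)$ is activated, then $$x_i(k+1)=x_i(k)+w_{ij}(x_j(k)-x_i(k))+\epsilon w_{ij}s_i(k),\qquad s_i(k+1)=s_i(k)+s_j(k)-(x_i(k+1)-x_i(k)),$$ $$x_j(k+1)=x_j(k),\qquad s_j(k+1)=0,$$ and all other nodes keep their state and surplus. The initial condition is $s(0)=0$ with $x(0)\in\mathbb{R}^n$ arbitrary. Almost sure average consensus: for every $x(0)$, $(x(k),s(k))\to(x_a\mathbf{1},0)$ as $k\to\infty$ with probability one, where $x_a=\mathbf{1}^Tx(0)/n$. *)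

theory Defs
  imports "HOL-Probability.Probability"
begin

text \<open>Nodes are 0,...,n-1. An edge (j,i) in E means that j sends to i.
  p i j and w i j are the activation probability and updating weight of edge (j,i).
  State of the network: a pair (x, s) of state vector and surplus vector.\<close>

definition strongly_connected :: "nat \<Rightarrow> (nat \<times> nat) set \<Rightarrow> bool" where
  "strongly_connected n E \<longleftrightarrow> (\<forall>i<n. \<forall>j<n. (i, j) \<in> E\<^sup>*)"

text \<open>Distribution of the activated edge at each time step.\<close>
definition edge_pmf :: "(nat \<times> nat) set \<Rightarrow> (nat \<Rightarrow> nat \<Rightarrow> real) \<Rightarrow> (nat \<times> nat) pmf" where
  "edge_pmf E p = embed_pmf (\<lambda>(j, i). if (j, i) \<in> E then p i j else 0)"

text \<open>One update of the gossip algorithm when edge (j,i) is activated.\<close>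
definition gossip_step ::
  "(nat \<Rightarrow> nat \<Rightarrow> real) \<Rightarrow> real \<Rightarrow> nat \<times> nat \<Rightarrow>
   (nat \<Rightarrow> real) \<times> (nat \<Rightarrow> real) \<Rightarrow> (nat \<Rightarrow> real) \<times> (nat \<Rightarrow> real)" where
  "gossip_step w \<epsilon> e xs =
     (case e of (j, i) \<Rightarrow> case xs of (x, s) \<Rightarrow>
       (let xi' = x i + w i j * (x j - x i) + \<epsilon> * w i j * s i
        in (x(i := xi'), s(i := s i + s j - (xi' - x i), j := 0))))"

text \<open>Trajectory driven by the sequence of activated edges \<omega>, with s(0) = 0.\<close>
primrec gossip_traj ::
  "(nat \<Rightarrow> nat \<Rightarrow> real) \<Rightarrow> real \<Rightarrow> (nat \<Rightarrow> real) \<Rightarrow> (nat \<times> nat) stream \<Rightarrow> nat \<Rightarrow>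
   (nat \<Rightarrow> real) \<times> (nat \<Rightarrow> real)" where
  "gossip_traj w \<epsilon> x0 \<omega> 0 = (x0, (\<lambda>_. 0))"
| "gossip_traj w \<epsilon> x0 \<omega> (Suc k) = gossip_step w \<epsilon> (\<omega> !! k) (gossip_traj w \<epsilon> x0 \<omega> k)"

text \<open>Almost sure average consensus: for every initial state, with probability one
  (edges drawn i.i.d. from edge_pmf) x(k) \<rightarrow> x_a 1 and s(k) \<rightarrow> 0.\<close>
definition as_average_consensus ::
  "nat \<Rightarrow> (nat \<times> nat) set \<Rightarrow> (nat \<Rightarrow> nat \<Rightarrow> real) \<Rightarrow> (nat \<Rightarrow> nat \<Rightarrow> real) \<Rightarrow> real \<Rightarrow> bool" where
  "as_average_consensus n E p w \<epsilon> \<longleftrightarrow>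
     (\<forall>x0 :: nat \<Rightarrow> real.
        AE \<omega> in stream_space (measure_pmf (edge_pmf E p)).
          (\<forall>i<n. (\<lambda>k. fst (gossip_traj w \<epsilon> x0 \<omega> k) i) \<longlonglongrightarrow> (\<Sum>l<n. x0 l) / real n) \<and>
          (\<forall>i<n. (\<lambda>k. snd (gossip_traj w \<epsilon> x0 \<omega> k) i) \<longlonglongrightarrow> 0))"

end

theory Submission
  imports Defs "Jordan_Normal_Form.Determinant"
begin

text \<open>
  The proof of sufficiency exhibits a one-step Lyapunov function. Shift the states so that the
  conserved total \<open>\<Sum>x + \<Sum>s\<close> is zero. If \<open>\<pi>\<close> is the stationary distribution of the chain with rates
  \<open>p i j * w i j\<close>, then at \<open>\<epsilon> = 0\<close> the energy \<open>\<Sum>\<pi> x\<^sup>2\<close> decreases on average by a multiple of the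
  squared differences along the edges, and to first order in \<open>\<epsilon>\<close> it changes by a positive multiple of
  \<open>- (\<Sum>s)\<^sup>2\<close>, provided that the surplus has a constant sign. The failure of the latter is measured by
  \<open>(\<Sum>\<bar>s\<bar>)\<^sup>2 - (\<Sum>s)\<^sup>2\<close>. At \<open>\<epsilon> = 0\<close> and up to state differences, surpluses are transported like
  coalescing tokens, and surpluses of opposite sign annihilate when they meet; weighting each pair of
  nodes by a bound \<open>h a b\<close> for the meeting time of two tokens gives a second energy whose drift
  absorbs this defect. A combination of the two energies has expected decrease bounded below by a
  multiple of the squared disagreement plus the squared surplus, so these are summable in expectation
  and tend to zero almost surely.

  Conversely, if \<open>j\<close> is not reachable from \<open>i\<close>, start with state 1 on the nodes reachable from \<open>i\<close> and 0
  elsewhere: the state of \<open>j\<close> stays 0 although the average is positive.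
\<close>

section \<open>Stationary weights of the edge chain\<close>

text \<open>The matrix \<open>A\<close> below is the generator of the chain that jumps against the
  edges, from \<open>snd e\<close> to \<open>fst e\<close> at rate \<open>q e\<close>. It kills
  constants, hence is singular and has a nonzero left null vector \<open>v\<close>. This is a signed
  stationary measure; absolute values make it nonnegative, and strong connectivity excludes
  zeros.\<close>

lemma stationary_weights_exist:
  fixes q :: "nat \<times> nat \<Rightarrow> real"
  assumes E: "E \<subseteq> {..<n} \<times> {..<n}" and n: "n > 0"
    and q: "\<And>e. e \<in> E \<Longrightarrow> q e > 0" and sc: "strongly_connected n E"
  obtains \<pi> :: "nat \<Rightarrow> real" where "\<And>i. i < n \<Longrightarrow> \<pi> i > 0"
    and "\<And>f. (\<Sum>e\<in>E. \<pi> (snd e) * q e * (f (fst e) - f (snd e))) = 0"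
proof -
  have fin: "finite E" using E by (rule finite_subset) simp
  have En: "fst e < n" "snd e < n" if "e \<in> E" for e using that E by auto
  define b :: "nat \<Rightarrow> nat \<Rightarrow> real" where "b x k = of_bool (x = k)" for x k
  have sum_b: "(\<Sum>k<n. f k * b x k) = f x" if "x < n" for f x
    using that by (simp add: b_def of_bool_def if_distrib cong: if_cong)
  define A where "A = Matrix.mat n n (\<lambda>(i, k). \<Sum>e\<in>E. b (snd e) i * (q e * (b (fst e) k - b (snd e) k)))"
  have A: "A \<in> carrier_mat n n" by (simp add: A_def)
  define u :: "real Matrix.vec" where "u = Matrix.vec n (\<lambda>_. 1)"
  have "A *\<^sub>v u = 0\<^sub>v n"
  proof (rule eq_vecI)
    fix i assume i: "i < dim_vec (0\<^sub>v n :: real Matrix.vec)"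
    have "vec_index (A *\<^sub>v u) i = (\<Sum>k<n. \<Sum>e\<in>E. b (snd e) i * (q e * (b (fst e) k - b (snd e) k)))"
      using i by (simp add: A_def u_def scalar_prod_def lessThan_atLeast0)
    also have "\<dots> = (\<Sum>e\<in>E. b (snd e) i * (q e * (\<Sum>k<n. b (fst e) k - b (snd e) k)))"
      by (subst sum.swap) (simp add: sum_distrib_left)
    also have "\<dots> = 0"
      using sum_b[of _ "\<lambda>_. 1"] En by (auto intro!: sum.neutral simp: sum_subtractf)
    finally show "vec_index (A *\<^sub>v u) i = vec_index (0\<^sub>v n) i" using i by simp
  qed (simp add: A_def)
  moreover have "u \<in> carrier_vec n" by (simp add: u_def)
  moreover have "u \<noteq> 0\<^sub>v n"
  proof
    assume "u = 0\<^sub>v n"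
    then have "vec_index u 0 = vec_index (0\<^sub>v n) 0" by simp
    then show False using n by (simp add: u_def)
  qed
  ultimately have "Determinant.det A = 0"
    using det_0_iff_vec_prod_zero_field[OF A] by blast
  then have "Determinant.det (transpose_mat A) = 0"
    using Determinant.det_transpose[OF A] by simp
  then obtain v' where v': "v' \<in> carrier_vec n" "v' \<noteq> 0\<^sub>v n" "transpose_mat A *\<^sub>v v' = 0\<^sub>v n"
    using det_0_iff_vec_prod_zero_field[of "transpose_mat A" n] A by auto
  define v where "v = vec_index v'"
  have v: "(\<Sum>e\<in>E. v (snd e) * q e * b (fst e) k) = (\<Sum>e\<in>E. v (snd e) * q e * b (snd e) k)"
    if k: "k < n" for k
  proof -
    have "0 = vec_index (transpose_mat A *\<^sub>v v') k" using v'(3) k by simp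
    also have "\<dots> = (\<Sum>i<n. (\<Sum>e\<in>E. b (snd e) i * (q e * (b (fst e) k - b (snd e) k))) * v i)"
      using k v'(1) by (simp add: A_def v_def scalar_prod_def lessThan_atLeast0)
    also have "\<dots> = (\<Sum>e\<in>E. q e * (b (fst e) k - b (snd e) k) * (\<Sum>i<n. v i * b (snd e) i))"
      by (simp add: sum_distrib_left sum_distrib_right) (subst sum.swap, simp add: mult_ac)
    also have "\<dots> = (\<Sum>e\<in>E. q e * (b (fst e) k - b (snd e) k) * v (snd e))"
      by (intro sum.cong) (simp_all add: sum_b En)
    finally show ?thesis by (simp add: algebra_simps sum_subtractf)
  qed
  \<comment> \<open>The absolute values are subharmonic, and the defects sum to zero, so they are again stationary.\<close>
  define F where "F k = (\<Sum>e\<in>E. \<bar>v (snd e)\<bar> * q e * (b (fst e) k - b (snd e) k))" for k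
  have F_eq: "F k = (\<Sum>e\<in>E. \<bar>v (snd e)\<bar> * q e * b (fst e) k) - \<bar>v k\<bar> * (\<Sum>e\<in>E. q e * b (snd e) k)" for k
    unfolding F_def sum_distrib_left sum_subtractf[symmetric]
    by (intro sum.cong) (auto simp: b_def algebra_simps)
  have F_nonneg: "F k \<ge> 0" if k: "k < n" for k
  proof -
    have "\<bar>v k\<bar> * (\<Sum>e\<in>E. q e * b (snd e) k) = \<bar>v k * (\<Sum>e\<in>E. q e * b (snd e) k)\<bar>"
      using q by (simp add: abs_mult abs_of_nonneg sum_nonneg b_def less_imp_le)
    also have "v k * (\<Sum>e\<in>E. q e * b (snd e) k) = (\<Sum>e\<in>E. v (snd e) * q e * b (snd e) k)"
      unfolding sum_distrib_left by (intro sum.cong) (auto simp: b_def)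
    also have "\<dots> = (\<Sum>e\<in>E. v (snd e) * q e * b (fst e) k)" using v[OF k] by simp
    also have "\<bar>\<dots>\<bar> \<le> (\<Sum>e\<in>E. \<bar>v (snd e) * q e * b (fst e) k\<bar>)" by (rule sum_abs)
    also have "\<dots> = (\<Sum>e\<in>E. \<bar>v (snd e)\<bar> * q e * b (fst e) k)"
      by (intro sum.cong) (auto simp: b_def abs_mult dest: q)
    finally show ?thesis by (simp add: F_eq)
  qed
  have decomp: "(\<Sum>e\<in>E. \<bar>v (snd e)\<bar> * q e * (f (fst e) - f (snd e))) = (\<Sum>k<n. f k * F k)" for f
  proof -
    have "(\<Sum>k<n. f k * F k)
      = (\<Sum>e\<in>E. \<bar>v (snd e)\<bar> * q e * ((\<Sum>k<n. f k * b (fst e) k) - (\<Sum>k<n. f k * b (snd e) k)))"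
      unfolding F_def sum_subtractf[symmetric] sum_distrib_left
      by (subst sum.swap) (simp add: algebra_simps)
    then show ?thesis by (simp add: sum_b En cong: sum.cong)
  qed
  from decomp[of "\<lambda>_. 1"] have "(\<Sum>k<n. F k) = 0" by simp
  then have F0: "F k = 0" if "k < n" for k
    using sum_nonneg_eq_0_iff[of "{..<n}" F] F_nonneg that by auto
  \<comment> \<open>Stationarity at a zero \<open>k\<close> makes the total inflow into
    \<open>k\<close> vanish, and with it each of its nonnegative summands. So zeros spread along
    edges.\<close>
  have step: "v i = 0" if ki: "(k, i) \<in> E" and "v k = 0" for k i
  proof -
    have "(\<Sum>e\<in>E. \<bar>v (snd e)\<bar> * q e * b (fst e) k) = 0"
      using F0[of k] F_eq[of k] that En[OF ki] by simp
    moreover have "\<bar>v (snd e)\<bar> * q e * b (fst e) k \<ge> 0" if "e \<in> E" for e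
      using q[OF that] by (simp add: b_def)
    ultimately have "\<bar>v (snd (k, i))\<bar> * q (k, i) * b (fst (k, i)) k = 0"
      using sum_nonneg_eq_0_iff[OF fin, of "\<lambda>e. \<bar>v (snd e)\<bar> * q e * b (fst e) k"] ki by blast
    then show ?thesis using q[OF ki] by (simp add: b_def)
  qed
  have nz: "v k \<noteq> 0" if k: "k < n" for k
  proof
    assume k0: "v k = 0"
    have "v l = 0" if "l < n" for l
    proof -
      have "(k, l) \<in> E\<^sup>*" using sc k that by (simp add: strongly_connected_def)
      then show ?thesis using k0 by (induction rule: rtrancl_induct) (auto intro: step)
    qed
    then have "v' = 0\<^sub>v n" using v'(1) by (intro eq_vecI) (auto simp: v_def)
    then show False using v'(2) by simp
  qed
  show thesis
  proof (rule that[of "\<lambda>i. \<bar>v i\<bar>"])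
    show "\<bar>v i\<bar> > 0" if "i < n" for i using nz[OF that] by simp
    show "(\<Sum>e\<in>E. \<bar>v (snd e)\<bar> * q e * (f (fst e) - f (snd e))) = 0" for f
      unfolding decomp using F0 by simp
  qed
qed

section \<open>Meeting time of two tokens\<close>

text \<open>A token travels like surplus: an activated edge carries it from the sender to the
  receiver. Two tokens driven by the same edges stay together once they have met.\<close>

definition move_token :: "nat \<times> nat \<Rightarrow> nat \<Rightarrow> nat" where
  "move_token e a = (if a = fst e then snd e else a)"

text \<open>A drift of -1 while the tokens are apart makes \<open>h\<close> a bound for their
  expected meeting time. The witness decreases geometrically in the closeness of \<open>a\<close> to
  \<open>b\<close>, measured by the directed distance \<open>d a b\<close>.\<close>

lemma coalescence_potential_exists:
  fixes P :: "nat \<times> nat \<Rightarrow> real"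
  assumes E: "E \<subseteq> {..<n} \<times> {..<n}" and n: "n > 0"
    and P: "\<And>e. e \<in> E \<Longrightarrow> P e > 0" "(\<Sum>e\<in>E. P e) = 1" and sc: "strongly_connected n E"
  obtains h :: "nat \<Rightarrow> nat \<Rightarrow> real" and H where "\<And>a b. 0 \<le> h a b" "\<And>a b. h a b \<le> H"
    and "\<And>a b. a < n \<Longrightarrow> b < n \<Longrightarrow> a \<noteq> b \<Longrightarrow>
      (\<Sum>e\<in>E. P e * h (move_token e a) (move_token e b)) \<le> h a b - 1"
proof -
  have fin: "finite E" using E by (rule finite_subset) simp
  define d where "d a b = (LEAST k. (a, b) \<in> E ^^ k)" for a b
  have d_le: "d a b \<le> k" if "(a, b) \<in> E ^^ k" for a b k
    unfolding d_def using that by (rule Least_le)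
  define N where "N = Max (case_prod d ` ({..<n} \<times> {..<n}))"
  have dN: "d a b \<le> N" if "a < n" "b < n" for a b
    unfolding N_def using that by (intro Max_ge) (auto intro!: image_eqI[of _ _ "(a, b)"])
  have E_ne: "E \<noteq> {}" using P(2) by auto
  \<comment> \<open>One more step of distance costs a factor \<theta> in \<open>f\<close>, whereas
    every edge has probability at least 2 * \<theta>; the halving is what produces the doubling
    below.\<close>
  define \<theta> where "\<theta> = Min (P ` E) / 2"
  have P_ge: "P e \<ge> 2 * \<theta>" if "e \<in> E" for e
    using that fin by (simp add: \<theta>_def)
  have \<theta>0: "\<theta> > 0" using P(1) fin E_ne by (simp add: \<theta>_def)
  obtain e0 where e0: "e0 \<in> E" using E_ne by blast
  have "P e0 \<le> (\<Sum>e\<in>E. P e)"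
    by (rule member_le_sum) (use e0 fin P(1) in \<open>auto intro: less_imp_le\<close>)
  then have \<theta>1: "\<theta> \<le> 1" using P_ge[OF e0] P(2) \<theta>0 by simp
  define f where "f a b = \<theta> ^ d a b" for a b
  have f: "0 \<le> f a b" "f a b \<le> 1" for a b
    using \<theta>0 \<theta>1 by (auto simp: f_def power_le_one)
  have f_N: "f a b \<ge> \<theta> ^ N" if "a < n" "b < n" for a b
    unfolding f_def using \<theta>0 \<theta>1 dN[OF that] by (intro power_decreasing) auto
  have key: "(\<Sum>e\<in>E. P e * f (move_token e a) (move_token e b)) \<ge> f a b + \<theta> ^ N"
    if ab: "a < n" "b < n" "a \<noteq> b" for a b
  proof -
    have "(a, b) \<in> E\<^sup>*" using sc ab by (simp add: strongly_connected_def)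
    then obtain k where "(a, b) \<in> E ^^ k" using rtrancl_imp_relpow by blast
    then have dab: "(a, b) \<in> E ^^ d a b" unfolding d_def by (rule LeastI)
    with \<open>a \<noteq> b\<close> obtain m where m: "d a b = Suc m" by (cases "d a b") auto
    with dab obtain a' where a': "(a, a') \<in> E" "(a', b) \<in> E ^^ m"
      using relpow_Suc_D2[of a b m E] by auto
    have "\<theta> ^ m \<le> f a' b"
      unfolding f_def using \<theta>0 \<theta>1 d_le[OF a'(2)] by (intro power_decreasing) auto
    then have "2 * \<theta> * \<theta> ^ m \<le> P (a, a') * f a' b"
      using P_ge[OF a'(1)] \<theta>0 by (intro mult_mono) auto
    also have "\<dots> = P (a, a') * f (move_token (a, a') a) (move_token (a, a') b)"
      using \<open>a \<noteq> b\<close> by (simp add: move_token_def)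
    also have "\<dots> \<le> (\<Sum>e\<in>E. P e * f (move_token e a) (move_token e b))"
      by (rule member_le_sum[of "(a, a')" E "\<lambda>e. P e * f (move_token e a) (move_token e b)"])
        (use a'(1) fin P(1) f(1) in \<open>auto simp: less_imp_le\<close>)
    \<comment> \<open>The sum is at least 2 * \<open>f a b\<close>, and one of the two copies is at
      least \<open>\<theta> ^ N\<close>: the doubling becomes a uniform additive gain.\<close>
    finally show ?thesis using f_N[OF ab(1,2)] by (simp add: f_def m)
  qed
  \<comment> \<open>With probability at least \<open>2 * \<theta>\<close> the first token moves one step closer to the second, which at
    least doubles the expected value of \<open>f\<close>; hence \<open>1 - f\<close>, rescaled, is the required potential.\<close>
  define C where "C = 1 / \<theta> ^ N"
  have C: "C > 0" "C * \<theta> ^ N = 1" using \<theta>0 by (auto simp: C_def)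
  show thesis
  proof (rule that[of "\<lambda>a b. C * (1 - f a b)" C])
    show "0 \<le> C * (1 - f a b)" "C * (1 - f a b) \<le> C" for a b
      using C f[of a b] by (auto simp: algebra_simps)
    fix a b assume ab: "a < n" "b < n" "a \<noteq> b"
    have "(\<Sum>e\<in>E. P e * (C * (1 - f (move_token e a) (move_token e b))))
      = C * ((\<Sum>e\<in>E. P e) - (\<Sum>e\<in>E. P e * f (move_token e a) (move_token e b)))"
      by (simp add: sum_distrib_left sum_subtractf algebra_simps)
    also have "\<dots> \<le> C * (1 - (f a b + \<theta> ^ N))"
      using key[OF ab] C(1) P(2) by simp
    also have "\<dots> = C * (1 - f a b) - 1" using C(2) by (simp add: algebra_simps)
    finally show "(\<Sum>e\<in>E. P e * (C * (1 - f (move_token e a) (move_token e b)))) \<le> C * (1 - f a b) - 1" .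
  qed
qed

section \<open>Drift criterion for random iterations\<close>

primrec iterate_stream :: "('e \<Rightarrow> 'z \<Rightarrow> 'z) \<Rightarrow> 'z \<Rightarrow> 'e stream \<Rightarrow> nat \<Rightarrow> 'z" where
  "iterate_stream f z \<omega> 0 = z"
| "iterate_stream f z \<omega> (Suc k) = f (\<omega> !! k) (iterate_stream f z \<omega> k)"

lemma iterate_stream_Stream:
  "iterate_stream f z (e ## \<omega>) (Suc k) = iterate_stream f (f e z) \<omega> k"
  by (induction k) simp_all

text \<open>The state space carries the discrete sigma-algebra, so that any \<open>f\<close> and any
  function of the state are measurable. This is consistent because each step splits into countably
  many cases, one for each edge.\<close>

lemma measurable_iterate_stream:
  fixes f :: "'e::countable \<Rightarrow> 'z \<Rightarrow> 'z" and P :: "'e pmf"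
  shows "(\<lambda>\<omega>. iterate_stream f z \<omega> k) \<in> stream_space (measure_pmf P) \<rightarrow>\<^sub>M count_space UNIV"
proof (induction k)
  case (Suc k)
  have meas: "(\<lambda>\<omega>. \<omega> !! k) \<in> stream_space (measure_pmf P) \<rightarrow>\<^sub>M count_space UNIV"
    using measurable_snth[of k "measure_pmf P"]
    by (simp only: measurable_cong_sets[OF refl sets_measure_pmf_count_space])
  show ?case
    unfolding iterate_stream.simps
  proof (rule measurable_compose_countable[where f = "\<lambda>e \<omega>. f e (iterate_stream f z \<omega> k)", OF _ meas])
    show "(\<lambda>\<omega>. f e (iterate_stream f z \<omega> k)) \<in> stream_space (measure_pmf P) \<rightarrow>\<^sub>M count_space UNIV" for e
      by (rule measurable_compose[OF Suc]) simp
  qed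
qed simp

text \<open>Conditioning on the first edge turns the rest of the stream into a run from
  \<open>f e z\<close>; hence the induction is over all starting points in \<open>I\<close>, and the
  drift telescopes.\<close>

lemma nn_integral_iterate_stream_le:
  fixes f :: "'e::countable \<Rightarrow> 'z \<Rightarrow> 'z" and P :: "'e pmf" and V W :: "'z \<Rightarrow> ennreal"
  assumes I: "\<And>e z. e \<in> set_pmf P \<Longrightarrow> z \<in> I \<Longrightarrow> f e z \<in> I"
    and drift: "\<And>z. z \<in> I \<Longrightarrow> W z + (\<integral>\<^sup>+e. V (f e z) \<partial>measure_pmf P) \<le> V z"
    and z: "z \<in> I"
  shows "(\<integral>\<^sup>+\<omega>. (\<Sum>k<K. W (iterate_stream f z \<omega> k)) \<partial>stream_space (measure_pmf P)) \<le> V z"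
  using z
proof (induction K arbitrary: z)
  case (Suc K)
  interpret S: prob_space "stream_space (measure_pmf P)"
    by (rule prob_space.prob_space_stream_space) (rule measure_pmf.prob_space_axioms)
  have [measurable]: "(\<lambda>\<omega>. W (iterate_stream f z \<omega> k)) \<in> borel_measurable (stream_space (measure_pmf P))" for z k
    by (rule measurable_compose[OF measurable_iterate_stream]) simp
  have "(\<integral>\<^sup>+\<omega>. (\<Sum>k<Suc K. W (iterate_stream f z \<omega> k)) \<partial>stream_space (measure_pmf P))
    = (\<integral>\<^sup>+e. \<integral>\<^sup>+\<omega>. (\<Sum>k<Suc K. W (iterate_stream f z (e ## \<omega>) k)) \<partial>stream_space (measure_pmf P) \<partial>measure_pmf P)"
    by (rule prob_space.nn_integral_stream_space[OF measure_pmf.prob_space_axioms]) measurable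
  also have "\<dots> = (\<integral>\<^sup>+e. W z + (\<integral>\<^sup>+\<omega>. (\<Sum>k<K. W (iterate_stream f (f e z) \<omega> k)) \<partial>stream_space (measure_pmf P)) \<partial>measure_pmf P)"
    by (simp add: sum.lessThan_Suc_shift iterate_stream_Stream nn_integral_add S.emeasure_space_1
        del: sum.lessThan_Suc iterate_stream.simps(2))
  also have "\<dots> \<le> (\<integral>\<^sup>+e. W z + V (f e z) \<partial>measure_pmf P)"
    by (rule nn_integral_mono_AE)
      (use Suc I in \<open>auto simp: AE_measure_pmf_iff intro!: add_left_mono\<close>)
  also have "\<dots> = W z + (\<integral>\<^sup>+e. V (f e z) \<partial>measure_pmf P)"
    by (simp add: nn_integral_add)
  also have "\<dots> \<le> V z" by (rule drift) fact
  finally show ?case .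
qed simp

text \<open>The expected value of the whole series of \<open>W\<close> is at most
  \<open>V z\<close>, hence finite. So almost surely the series converges, and its terms tend to
  zero.\<close>

lemma AE_iterate_stream_tendsto_0:
  fixes f :: "'e::countable \<Rightarrow> 'z \<Rightarrow> 'z" and P :: "'e pmf" and V W :: "'z \<Rightarrow> real"
  assumes I: "\<And>e z. e \<in> set_pmf P \<Longrightarrow> z \<in> I \<Longrightarrow> f e z \<in> I"
    and W: "\<And>z. 0 \<le> W z"
    and drift: "\<And>z. z \<in> I \<Longrightarrow> ennreal (W z) + (\<integral>\<^sup>+e. ennreal (V (f e z)) \<partial>measure_pmf P) \<le> ennreal (V z)"
    and z: "z \<in> I"
  shows "AE \<omega> in stream_space (measure_pmf P). (\<lambda>k. W (iterate_stream f z \<omega> k)) \<longlonglongrightarrow> 0"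
proof -
  let ?S = "stream_space (measure_pmf P)"
  have [measurable]: "(\<lambda>\<omega>. ennreal (W (iterate_stream f z \<omega> k))) \<in> borel_measurable ?S" for k
    by (rule measurable_compose[OF measurable_iterate_stream]) simp
  have "(\<integral>\<^sup>+\<omega>. (\<Sum>k. ennreal (W (iterate_stream f z \<omega> k))) \<partial>?S)
    = (\<Sum>k. \<integral>\<^sup>+\<omega>. ennreal (W (iterate_stream f z \<omega> k)) \<partial>?S)"
    by (rule nn_integral_suminf) measurable
  also have "\<dots> \<le> ennreal (V z)"
  proof (rule suminf_le_const)
    show "(\<Sum>k<K. \<integral>\<^sup>+\<omega>. ennreal (W (iterate_stream f z \<omega> k)) \<partial>?S) \<le> ennreal (V z)" for K
      using nn_integral_iterate_stream_le[of P I f "\<lambda>z. ennreal (W z)" "\<lambda>z. ennreal (V z)" z K] I drift z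
      by (subst nn_integral_sum[symmetric]) auto
  qed simp
  finally have "(\<integral>\<^sup>+\<omega>. (\<Sum>k. ennreal (W (iterate_stream f z \<omega> k))) \<partial>?S) \<noteq> \<infinity>"
    by (auto simp: top_unique)
  then have "AE \<omega> in ?S. (\<Sum>k. ennreal (W (iterate_stream f z \<omega> k))) \<noteq> \<infinity>"
    by (intro nn_integral_noteq_infinite) measurable
  then show ?thesis
  proof (rule AE_mp, intro AE_I2 impI)
    fix \<omega> assume "(\<Sum>k. ennreal (W (iterate_stream f z \<omega> k))) \<noteq> \<infinity>"
    then have "summable (\<lambda>k. W (iterate_stream f z \<omega> k))"
      using W by (intro summable_suminf_not_top) auto
    then show "(\<lambda>k. W (iterate_stream f z \<omega> k)) \<longlonglongrightarrow> 0" by (rule summable_LIMSEQ_zero)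
  qed
qed

section \<open>Surpluses of opposite sign\<close>

text \<open>Zero for reals of equal sign, and twice \<open>\<bar>u * v\<bar>\<close> for reals of opposite sign.\<close>

definition opposition :: "real \<Rightarrow> real \<Rightarrow> real" where
  "opposition u v = \<bar>u\<bar> * \<bar>v\<bar> - u * v"

lemma opposition_nonneg: "0 \<le> opposition u v"
  unfolding opposition_def using abs_ge_self[of "u * v"] by (simp add: abs_mult)

lemma opposition_self: "opposition u u = 0"
  by (simp add: opposition_def abs_mult[symmetric])

lemma opposition_commute: "opposition u v = opposition v u"
  by (simp add: opposition_def mult.commute)

text \<open>This identifies the sign defect left over by the state energy with the quantity that the
  pair energy dissipates.\<close>

lemma opposition_sum_sum:
  "(\<Sum>a\<in>A. \<Sum>b\<in>A. opposition (s a) (s b)) = (\<Sum>a\<in>A. \<bar>s a\<bar>)\<^sup>2 - (\<Sum>a\<in>A. s a)\<^sup>2"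
  by (simp add: opposition_def power2_eq_square sum_product sum_subtractf)

text \<open>Merging surpluses can only cancel opposition: the product is bilinear, and the absolute
  values are subadditive.\<close>

lemma opposition_sum_le:
  "opposition (\<Sum>a\<in>A. f a) (\<Sum>b\<in>B. g b) \<le> (\<Sum>a\<in>A. \<Sum>b\<in>B. opposition (f a) (g b))"
proof -
  have "\<bar>\<Sum>a\<in>A. f a\<bar> * \<bar>\<Sum>b\<in>B. g b\<bar> \<le> (\<Sum>a\<in>A. \<bar>f a\<bar>) * (\<Sum>b\<in>B. \<bar>g b\<bar>)"
    by (intro mult_mono sum_abs) (auto intro: sum_nonneg)
  then show ?thesis by (simp add: opposition_def sum_product sum_subtractf)
qed

lemma opposition_add_le: "opposition (u + d) v \<le> opposition u v + 2 * \<bar>d\<bar> * \<bar>v\<bar>"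
proof -
  have "\<bar>u + d\<bar> * \<bar>v\<bar> \<le> (\<bar>u\<bar> + \<bar>d\<bar>) * \<bar>v\<bar>" by (intro mult_right_mono) auto
  moreover have "- (d * v) \<le> \<bar>d\<bar> * \<bar>v\<bar>" using abs_ge_minus_self[of "d * v"] by (simp add: abs_mult)
  ultimately show ?thesis by (simp add: opposition_def algebra_simps)
qed

section \<open>The network, its disagreement and its surplus mass\<close>

locale gossip_network =
  fixes n :: nat and E :: "(nat \<times> nat) set" and p w :: "nat \<Rightarrow> nat \<Rightarrow> real"
  assumes n_gt_1: "n > 1" and E_sub: "E \<subseteq> {..<n} \<times> {..<n}"
    and no_loop: "e \<in> E \<Longrightarrow> fst e \<noteq> snd e"
    and p_pos: "e \<in> E \<Longrightarrow> 0 < p (snd e) (fst e)"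
    and p_sum: "(\<Sum>e\<in>E. p (snd e) (fst e)) = 1"
    and w_pos: "e \<in> E \<Longrightarrow> 0 < w (snd e) (fst e)"
    and w_less: "e \<in> E \<Longrightarrow> w (snd e) (fst e) < 1"
begin

abbreviation prob_edge :: "nat \<times> nat \<Rightarrow> real" where
  "prob_edge e \<equiv> p (snd e) (fst e)"

abbreviation weight :: "nat \<times> nat \<Rightarrow> real" where
  "weight e \<equiv> w (snd e) (fst e)"

definition increment :: "real \<Rightarrow> nat \<times> nat \<Rightarrow> (nat \<Rightarrow> real) \<Rightarrow> (nat \<Rightarrow> real) \<Rightarrow> real" where
  "increment \<epsilon> e x s = weight e * (x (fst e) - x (snd e)) + \<epsilon> * weight e * s (snd e)"

text \<open>The square root gives this the same degree of homogeneity as \<open>mass\<close>, so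
  that increments are bounded linearly in the two.\<close>

definition disagreement :: "(nat \<Rightarrow> real) \<Rightarrow> real" where
  "disagreement x = sqrt (\<Sum>e\<in>E. (x (fst e) - x (snd e))\<^sup>2)"

definition mass :: "(nat \<Rightarrow> real) \<Rightarrow> real" where
  "mass s = (\<Sum>a<n. \<bar>s a\<bar>)"

lemma finite_E: "finite E"
  using E_sub by (rule finite_subset) simp

lemma E_less: "e \<in> E \<Longrightarrow> fst e < n" "e \<in> E \<Longrightarrow> snd e < n"
  using E_sub by auto

lemma mass_nonneg: "0 \<le> mass s"
  by (simp add: mass_def sum_nonneg)

lemma abs_le_mass: "a < n \<Longrightarrow> \<bar>s a\<bar> \<le> mass s"
  unfolding mass_def by (rule member_le_sum) auto

lemma disagreement_nonneg: "0 \<le> disagreement x"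
  by (simp add: disagreement_def sum_nonneg)

lemma disagreement_sq: "(disagreement x)\<^sup>2 = (\<Sum>e\<in>E. (x (fst e) - x (snd e))\<^sup>2)"
  by (simp add: disagreement_def sum_nonneg)

lemma edge_diff_le_disagreement:
  assumes "e \<in> E" shows "\<bar>x (fst e) - x (snd e)\<bar> \<le> disagreement x"
proof -
  have "(x (fst e) - x (snd e))\<^sup>2 \<le> (\<Sum>e\<in>E. (x (fst e) - x (snd e))\<^sup>2)"
    by (rule member_le_sum[of e E "\<lambda>e. (x (fst e) - x (snd e))\<^sup>2"]) (use assms finite_E in auto)
  then show ?thesis
    unfolding disagreement_def using real_sqrt_le_mono by fastforce
qed

text \<open>A path of at most \<open>card E\<close> edges joins the two nodes, and each of its edges
  contributes at most one \<open>disagreement x\<close>.\<close>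

lemma diff_le_disagreement:
  assumes sc: "strongly_connected n E" and "a < n" "b < n"
  shows "\<bar>x a - x b\<bar> \<le> card E * disagreement x"
proof -
  have path: "\<bar>x a - x b\<bar> \<le> k * disagreement x" if "(a, b) \<in> E ^^ k" for k b
    using that
  proof (induction k arbitrary: b)
    case (Suc k)
    then obtain c where c: "(a, c) \<in> E ^^ k" "(c, b) \<in> E" by auto
    have "\<bar>x a - x b\<bar> \<le> \<bar>x a - x c\<bar> + \<bar>x c - x b\<bar>" by simp
    also have "\<dots> \<le> k * disagreement x + disagreement x"
      using Suc.IH[OF c(1)] edge_diff_le_disagreement[OF c(2), of x] by simp
    finally show ?case by (simp add: algebra_simps)
  qed simp
  have "(a, b) \<in> E\<^sup>*" using assms by (simp add: strongly_connected_def)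
  then obtain k where k: "k \<le> card E" "(a, b) \<in> E ^^ k"
    using rtrancl_finite_eq_relpow[OF finite_E] by auto
  have "real k * disagreement x \<le> card E * disagreement x"
    using k(1) disagreement_nonneg by (intro mult_right_mono) auto
  with path[OF k(2)] show ?thesis by simp
qed

lemma diff_mean_le_disagreement:
  assumes sc: "strongly_connected n E" and "a < n"
  shows "\<bar>x a - (\<Sum>b<n. x b) / n\<bar> \<le> card E * disagreement x"
proof -
  have "x a - (\<Sum>b<n. x b) / n = (\<Sum>b<n. x a - x b) / n"
    using n_gt_1 by (simp add: sum_subtractf field_simps)
  also have "\<bar>\<dots>\<bar> = \<bar>\<Sum>b<n. x a - x b\<bar> / n" by simp
  also have "\<dots> \<le> (\<Sum>b<n. card E * disagreement x) / n"
    using assms by (intro divide_right_mono order_trans[OF sum_abs] sum_mono diff_le_disagreement) auto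
  also have "\<dots> = card E * disagreement x" using n_gt_1 by simp
  finally show ?thesis .
qed

lemma increment_abs_le:
  assumes "e \<in> E" "0 \<le> \<epsilon>"
  shows "\<bar>increment \<epsilon> e x s\<bar> \<le> disagreement x + \<epsilon> * mass s"
proof -
  have w: "\<bar>weight e\<bar> \<le> 1" using w_pos[OF assms(1)] w_less[OF assms(1)] by simp
  have "\<bar>increment \<epsilon> e x s\<bar> \<le> \<bar>weight e\<bar> * \<bar>x (fst e) - x (snd e)\<bar> + \<bar>weight e\<bar> * (\<epsilon> * \<bar>s (snd e)\<bar>)"
    unfolding increment_def using assms(2)
    by (intro order_trans[OF abs_triangle_ineq]) (simp add: abs_mult mult_ac)
  also have "\<dots> \<le> 1 * disagreement x + 1 * (\<epsilon> * mass s)"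
    using w assms edge_diff_le_disagreement[OF assms(1)] abs_le_mass[OF E_less(2)[OF assms(1)]]
    by (intro add_mono mult_mono) auto
  finally show ?thesis by simp
qed

section \<open>Surplus transport and the drift of the pair energy\<close>

text \<open>The surplus update when the increment is zero. The true update additionally subtracts
  the increment at the receiver.\<close>

definition transport :: "nat \<times> nat \<Rightarrow> (nat \<Rightarrow> real) \<Rightarrow> nat \<Rightarrow> real" where
  "transport e s = s(snd e := s (snd e) + s (fst e), fst e := 0)"

lemma move_token_less: "e \<in> E \<Longrightarrow> a < n \<Longrightarrow> move_token e a < n"
  using E_less by (auto simp: move_token_def)

text \<open>Transport is the push-forward along \<open>move_token e\<close>: each node's surplus
  rides on a token, and tokens landing on one node add up.\<close>

lemma transport_eq_sum:
  assumes e: "e \<in> E" and c: "c < n"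
  shows "transport e s c = (\<Sum>a\<in>{a\<in>{..<n}. move_token e a = c}. s a)"
proof -
  note less = E_less[OF e] no_loop[OF e]
  have "{a\<in>{..<n}. move_token e a = c}
    = (if c = fst e then {} else if c = snd e then {snd e, fst e} else {c})"
    using less c by (auto simp: move_token_def)
  then show ?thesis using less by (simp add: transport_def)
qed

lemma mass_transport_le:
  assumes e: "e \<in> E" shows "mass (transport e s) \<le> mass s"
proof -
  have "mass (transport e s) \<le> (\<Sum>c<n. \<Sum>a\<in>{a\<in>{..<n}. move_token e a = c}. \<bar>s a\<bar>)"
    unfolding mass_def by (intro sum_mono) (simp add: transport_eq_sum[OF e] sum_abs)
  also have "\<dots> = mass s"
    unfolding mass_def using move_token_less[OF e] by (intro sum.group) auto
  finally show ?thesis .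
qed

definition pair_energy :: "(nat \<Rightarrow> nat \<Rightarrow> real) \<Rightarrow> (nat \<Rightarrow> real) \<Rightarrow> real" where
  "pair_energy h s = (\<Sum>a<n. \<Sum>b<n. h a b * opposition (s a) (s b))"

text \<open>By \<open>opposition_sum_le\<close> the opposition between two nodes after transport is
  at most that between the tokens that landed there. Regrouping the pairs by origin instead of
  destination gives the bound.\<close>

lemma pair_energy_transport_le:
  assumes e: "e \<in> E" and h: "\<And>a b. 0 \<le> h a b"
  shows "pair_energy h (transport e s)
    \<le> (\<Sum>a<n. \<Sum>b<n. h (move_token e a) (move_token e b) * opposition (s a) (s b))"
proof -
  define T where "T c = {a\<in>{..<n}. move_token e a = c}" for c
  have "pair_energy h (transport e s)
    \<le> (\<Sum>c<n. \<Sum>d<n. h c d * (\<Sum>a\<in>T c. \<Sum>b\<in>T d. opposition (s a) (s b)))"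
    unfolding pair_energy_def
  proof (intro sum_mono mult_left_mono h)
    fix c d assume "c \<in> {..<n}" "d \<in> {..<n}"
    then show "opposition (transport e s c) (transport e s d) \<le> (\<Sum>a\<in>T c. \<Sum>b\<in>T d. opposition (s a) (s b))"
      unfolding T_def by (simp only: lessThan_iff transport_eq_sum[OF e] opposition_sum_le)
  qed
  also have "\<dots> = (\<Sum>c<n. \<Sum>a\<in>T c. \<Sum>d<n. \<Sum>b\<in>T d. h (move_token e a) (move_token e b) * opposition (s a) (s b))"
  proof (rule sum.cong[OF refl])
    fix c
    have "(\<Sum>d<n. h c d * (\<Sum>a\<in>T c. \<Sum>b\<in>T d. opposition (s a) (s b)))
      = (\<Sum>a\<in>T c. \<Sum>d<n. \<Sum>b\<in>T d. h c d * opposition (s a) (s b))"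
      by (subst sum.swap) (simp add: sum_distrib_left)
    also have "\<dots> = (\<Sum>a\<in>T c. \<Sum>d<n. \<Sum>b\<in>T d. h (move_token e a) (move_token e b) * opposition (s a) (s b))"
      by (intro sum.cong refl) (simp add: T_def)
    finally show "(\<Sum>d<n. h c d * (\<Sum>a\<in>T c. \<Sum>b\<in>T d. opposition (s a) (s b))) = \<dots>" .
  qed
  also have "\<dots> = (\<Sum>a<n. \<Sum>d<n. \<Sum>b\<in>T d. h (move_token e a) (move_token e b) * opposition (s a) (s b))"
    unfolding T_def using move_token_less[OF e] by (intro sum.group) auto
  also have "\<dots> = (\<Sum>a<n. \<Sum>b<n. h (move_token e a) (move_token e b) * opposition (s a) (s b))"
  proof (rule sum.cong[OF refl])
    fix a
    show "(\<Sum>d<n. \<Sum>b\<in>T d. h (move_token e a) (move_token e b) * opposition (s a) (s b))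
      = (\<Sum>b<n. h (move_token e a) (move_token e b) * opposition (s a) (s b))"
      unfolding T_def using move_token_less[OF e] by (intro sum.group) auto
  qed
  finally show ?thesis .
qed

text \<open>Diagonal pairs have no opposition, so at most one member of a relevant pair is
  perturbed. Therefore the bound is linear in \<open>d\<close>, with no squared term.\<close>

lemma pair_energy_perturb_le:
  assumes h: "\<And>a b. 0 \<le> h a b" "\<And>a b. h a b \<le> H"
  shows "pair_energy h (s(i := s i + d)) \<le> pair_energy h s + 4 * H * \<bar>d\<bar> * mass s"
proof -
  define D where "D a = (if a = i then \<bar>d\<bar> else 0)" for a
  have H: "0 \<le> H" using h[of 0 0] by simp
  have "h a b * opposition ((s(i := s i + d)) a) ((s(i := s i + d)) b)
    \<le> h a b * opposition (s a) (s b) + 2 * H * (D a * \<bar>s b\<bar> + \<bar>s a\<bar> * D b)" (is "?l \<le> ?r") for a b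
  proof (cases "a = b")
    case True
    then show ?thesis using h H by (simp add: opposition_self opposition_nonneg D_def)
  next
    case False
    then have "opposition ((s(i := s i + d)) a) ((s(i := s i + d)) b)
      \<le> opposition (s a) (s b) + 2 * (D a * \<bar>s b\<bar> + \<bar>s a\<bar> * D b)"
      using opposition_add_le[of "s i" d "s b"] opposition_add_le[of "s i" d "s a"]
      by (auto simp: D_def opposition_commute mult_ac)
    then have "?l \<le> h a b * (opposition (s a) (s b) + 2 * (D a * \<bar>s b\<bar> + \<bar>s a\<bar> * D b))"
      using h by (intro mult_left_mono) auto
    also have "\<dots> = h a b * opposition (s a) (s b) + h a b * (2 * (D a * \<bar>s b\<bar> + \<bar>s a\<bar> * D b))"
      by (simp add: algebra_simps)
    also have "\<dots> \<le> h a b * opposition (s a) (s b) + H * (2 * (D a * \<bar>s b\<bar> + \<bar>s a\<bar> * D b))"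
      using h by (intro add_left_mono mult_right_mono) (auto simp: D_def)
    finally show ?thesis by (simp add: mult_ac)
  qed
  then have "pair_energy h (s(i := s i + d))
    \<le> (\<Sum>a<n. \<Sum>b<n. h a b * opposition (s a) (s b) + 2 * H * (D a * \<bar>s b\<bar> + \<bar>s a\<bar> * D b))"
    unfolding pair_energy_def by (intro sum_mono)
  also have "\<dots> = pair_energy h s + 2 * H * ((\<Sum>a<n. D a) * mass s + mass s * (\<Sum>a<n. D a))"
  proof -
    have "(\<Sum>a<n. \<Sum>b<n. D a * \<bar>s b\<bar> + \<bar>s a\<bar> * D b) = (\<Sum>a<n. D a) * mass s + mass s * (\<Sum>a<n. D a)"
      by (simp add: mass_def sum.distrib sum_product)
    then show ?thesis
      by (simp add: pair_energy_def sum.distrib sum_distrib_left[symmetric])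
  qed
  also have "\<dots> = pair_energy h s + 4 * H * (\<Sum>a<n. D a) * mass s" by (simp add: algebra_simps)
  also have "\<dots> \<le> pair_energy h s + 4 * H * \<bar>d\<bar> * mass s"
  proof -
    \<comment> \<open>Only an inequality, since \<open>i\<close> may lie outside the network, where
      the sum is zero.\<close>
    have "(\<Sum>a<n. D a) \<le> \<bar>d\<bar>" unfolding D_def by simp
    then show ?thesis using H mass_nonneg by (intro add_left_mono mult_right_mono mult_left_mono) auto
  qed
  finally show ?thesis .
qed

definition new_state :: "real \<Rightarrow> nat \<times> nat \<Rightarrow> (nat \<Rightarrow> real) \<Rightarrow> (nat \<Rightarrow> real) \<Rightarrow> nat \<Rightarrow> real" where
  "new_state \<epsilon> e x s = x(snd e := x (snd e) + increment \<epsilon> e x s)"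

definition new_surplus :: "real \<Rightarrow> nat \<times> nat \<Rightarrow> (nat \<Rightarrow> real) \<Rightarrow> (nat \<Rightarrow> real) \<Rightarrow> nat \<Rightarrow> real" where
  "new_surplus \<epsilon> e x s = (transport e s)(snd e := transport e s (snd e) - increment \<epsilon> e x s)"

lemma gossip_step_eq:
  assumes "e \<in> E"
  shows "gossip_step w \<epsilon> e (x, s) = (new_state \<epsilon> e x s, new_surplus \<epsilon> e x s)"
  using no_loop[OF assms]
  by (auto simp: gossip_step_def new_state_def new_surplus_def increment_def transport_def
      Let_def split_beta fun_eq_iff)

text \<open>Averaging the transported pairs over the edges lowers the weight of each pair of
  distinct nodes by at least one, which removes the total opposition. Subtracting the increment
  costs the last term.\<close>

lemma pair_energy_drift:
  assumes h: "\<And>a b. 0 \<le> h a b" "\<And>a b. h a b \<le> H"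
    and coal: "\<And>a b. a < n \<Longrightarrow> b < n \<Longrightarrow> a \<noteq> b \<Longrightarrow>
      (\<Sum>e\<in>E. prob_edge e * h (move_token e a) (move_token e b)) \<le> h a b - 1"
    and \<epsilon>: "0 \<le> \<epsilon>"
  shows "(\<Sum>e\<in>E. prob_edge e * pair_energy h (new_surplus \<epsilon> e x s))
    \<le> pair_energy h s - ((mass s)\<^sup>2 - (\<Sum>a<n. s a)\<^sup>2)
      + 4 * H * (disagreement x * mass s + \<epsilon> * (mass s)\<^sup>2)"
proof -
  have H: "0 \<le> H" using h[of 0 0] by simp
  let ?F = "4 * H * (disagreement x * mass s + \<epsilon> * (mass s)\<^sup>2)"
  let ?T = "\<lambda>e. \<Sum>a<n. \<Sum>b<n. h (move_token e a) (move_token e b) * opposition (s a) (s b)"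
  have "pair_energy h (new_surplus \<epsilon> e x s) \<le> ?T e + ?F" if e: "e \<in> E" for e
  proof -
    have "pair_energy h (new_surplus \<epsilon> e x s)
      \<le> pair_energy h (transport e s) + 4 * H * \<bar>- increment \<epsilon> e x s\<bar> * mass (transport e s)"
      unfolding new_surplus_def diff_conv_add_uminus by (rule pair_energy_perturb_le[OF h])
    also have "\<dots> \<le> ?T e + 4 * H * (disagreement x + \<epsilon> * mass s) * mass s"
      using pair_energy_transport_le[OF e h(1)] increment_abs_le[OF e \<epsilon>] mass_transport_le[OF e] H
        disagreement_nonneg mass_nonneg \<epsilon>
      by (intro add_mono mult_mono) auto
    also have "\<dots> = ?T e + ?F" by (simp add: algebra_simps power2_eq_square)
    finally show ?thesis .
  qed
  then have "(\<Sum>e\<in>E. prob_edge e * pair_energy h (new_surplus \<epsilon> e x s)) \<le> (\<Sum>e\<in>E. prob_edge e * (?T e + ?F))"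
    using p_pos by (intro sum_mono mult_left_mono) (auto simp: less_imp_le)
  also have "\<dots> = (\<Sum>e\<in>E. prob_edge e * ?T e) + ?F"
    using p_sum by (simp add: distrib_left sum.distrib sum_distrib_right[symmetric])
  also have "(\<Sum>e\<in>E. prob_edge e * ?T e) = (\<Sum>a<n. \<Sum>b<n.
      (\<Sum>e\<in>E. prob_edge e * h (move_token e a) (move_token e b)) * opposition (s a) (s b))"
    unfolding sum_distrib_left sum_distrib_right
    by (subst sum.swap, intro sum.cong refl, subst sum.swap, simp add: mult_ac)
  \<comment> \<open>The coalescence bound is available off the diagonal only; on the diagonal the
    opposition vanishes.\<close>
  also have "\<dots> \<le> (\<Sum>a<n. \<Sum>b<n. (h a b - 1) * opposition (s a) (s b))"
  proof (intro sum_mono)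
    fix a b assume "a \<in> {..<n}" "b \<in> {..<n}"
    then show "(\<Sum>e\<in>E. prob_edge e * h (move_token e a) (move_token e b)) * opposition (s a) (s b)
      \<le> (h a b - 1) * opposition (s a) (s b)"
      using coal[of a b] by (cases "a = b") (auto simp: opposition_self intro!: mult_right_mono opposition_nonneg)
  qed
  also have "\<dots> = pair_energy h s - (\<Sum>a<n. \<Sum>b<n. opposition (s a) (s b))"
    by (simp add: pair_energy_def left_diff_distrib sum_subtractf)
  also have "(\<Sum>a<n. \<Sum>b<n. opposition (s a) (s b)) = (mass s)\<^sup>2 - (\<Sum>a<n. s a)\<^sup>2"
    by (simp add: opposition_sum_sum mass_def)
  finally show ?thesis by simp
qed

section \<open>Drift of the state energy\<close>

lemma sum_fun_upd:
  fixes f :: "nat \<Rightarrow> real \<Rightarrow> real"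
  assumes "i < n"
  shows "(\<Sum>a<n. f a ((x(i := v)) a)) = (\<Sum>a<n. f a (x a)) + (f i v - f i (x i))"
proof -
  have "(\<Sum>a<n. f a ((x(i := v)) a)) = f i v + (\<Sum>a\<in>{..<n} - {i}. f a (x a))"
    using assms by (subst sum.remove[of _ i]) (auto intro!: sum.cong)
  moreover have "(\<Sum>a<n. f a (x a)) = f i (x i) + (\<Sum>a\<in>{..<n} - {i}. f a (x a))"
    using assms by (intro sum.remove) auto
  ultimately show ?thesis by simp
qed

lemma ex_in_edge:
  assumes sc: "strongly_connected n E" and a: "a < n"
  shows "\<exists>e\<in>E. snd e = a"
proof -
  define b :: nat where "b = (if a = 0 then 1 else 0)"
  have b: "b < n" "b \<noteq> a" using n_gt_1 by (auto simp: b_def)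
  then have "(b, a) \<in> E\<^sup>*" using sc a by (simp add: strongly_connected_def)
  with b(2) obtain c where "(c, a) \<in> E" by (blast elim: rtranclE)
  then show ?thesis by force
qed

text \<open>The product expands to the sum of \<open>G a * (s a * s b)\<close>, with
  \<open>G a\<close> the total rate into \<open>a\<close>, positive because every node has an
  in-edge. Replacing \<open>s a * s b\<close> by the product of absolute values costs exactly the
  opposition of the pair.\<close>

lemma total_times_inflow_ge:
  assumes K: "\<And>e. e \<in> E \<Longrightarrow> 0 < K e" and sc: "strongly_connected n E"
  obtains g where "g > 0"
    and "\<And>s. (\<Sum>a<n. s a) * (\<Sum>e\<in>E. K e * s (snd e))
      \<ge> g * (mass s)\<^sup>2 - (\<Sum>e\<in>E. K e) * ((mass s)\<^sup>2 - (\<Sum>a<n. s a)\<^sup>2)"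
proof -
  define G where "G a = (\<Sum>e\<in>{e\<in>E. snd e = a}. K e)" for a
  have G_pos: "G a > 0" if "a < n" for a
  proof -
    have "\<exists>e\<in>E. snd e = a" using sc that by (rule ex_in_edge)
    then show ?thesis unfolding G_def using K finite_E by (intro sum_pos) auto
  qed
  have G_le: "G a \<le> (\<Sum>e\<in>E. K e)" for a
    unfolding G_def using K finite_E by (intro sum_mono2) (auto simp: less_imp_le)
  define g where "g = Min (G ` {..<n})"
  have n0: "{..<n} \<noteq> {}" using n_gt_1 by auto
  have g: "g > 0" "\<And>a. a < n \<Longrightarrow> g \<le> G a"
    using G_pos n0 by (auto simp: g_def)
  have "(\<Sum>a<n. s a) * (\<Sum>e\<in>E. K e * s (snd e))
      \<ge> g * (mass s)\<^sup>2 - (\<Sum>e\<in>E. K e) * ((mass s)\<^sup>2 - (\<Sum>a<n. s a)\<^sup>2)" for s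
  proof -
    have "(\<Sum>e\<in>E. K e * s (snd e)) = (\<Sum>a<n. \<Sum>e\<in>{e\<in>E. snd e = a}. K e * s (snd e))"
      using finite_E E_less by (intro sum.group[symmetric]) auto
    also have "\<dots> = (\<Sum>a<n. G a * s a)"
      unfolding G_def sum_distrib_right by (intro sum.cong) auto
    finally have "(\<Sum>a<n. s a) * (\<Sum>e\<in>E. K e * s (snd e)) = (\<Sum>a<n. \<Sum>b<n. G a * (s a * s b))"
      by (subst sum.swap) (simp add: sum_product mult_ac)
    also have "\<dots> \<ge> (\<Sum>a<n. \<Sum>b<n. g * (\<bar>s a\<bar> * \<bar>s b\<bar>) - (\<Sum>e\<in>E. K e) * opposition (s a) (s b))"
    proof (intro sum_mono)
      fix a b assume "a \<in> {..<n}" "b \<in> {..<n}"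
      then have "g * (\<bar>s a\<bar> * \<bar>s b\<bar>) \<le> G a * (\<bar>s a\<bar> * \<bar>s b\<bar>)"
        "G a * opposition (s a) (s b) \<le> (\<Sum>e\<in>E. K e) * opposition (s a) (s b)"
        using g(2) G_le opposition_nonneg by (auto intro!: mult_right_mono)
      then show "g * (\<bar>s a\<bar> * \<bar>s b\<bar>) - (\<Sum>e\<in>E. K e) * opposition (s a) (s b) \<le> G a * (s a * s b)"
        by (simp add: opposition_def algebra_simps)
    qed
    moreover have "(\<Sum>a<n. \<Sum>b<n. g * (\<bar>s a\<bar> * \<bar>s b\<bar>) - (\<Sum>e\<in>E. K e) * opposition (s a) (s b))
      = g * (mass s)\<^sup>2 - (\<Sum>e\<in>E. K e) * ((mass s)\<^sup>2 - (\<Sum>a<n. s a)\<^sup>2)"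
      unfolding sum_subtractf sum_distrib_left[symmetric] opposition_sum_sum
      by (simp add: mass_def power2_eq_square sum_distrib_right)
    ultimately show ?thesis by simp
  qed
  with g(1) show thesis by (rule that)
qed

definition state_energy :: "(nat \<Rightarrow> real) \<Rightarrow> (nat \<Rightarrow> real) \<Rightarrow> real" where
  "state_energy \<pi> x = (\<Sum>a<n. \<pi> a * (x a)\<^sup>2)"

text \<open>The square is expanded so that the terms free of \<epsilon> split into a difference of
  squares, which stationarity will kill on average, and a dissipation with the factor
  \<open>1 - weight e\<close>.\<close>

lemma state_energy_new_state:
  assumes e: "e \<in> E"
  shows "state_energy \<pi> (new_state \<epsilon> e x s) = state_energy \<pi> x
    + \<pi> (snd e) * weight e * ((x (fst e))\<^sup>2 - (x (snd e))\<^sup>2)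
    - \<pi> (snd e) * weight e * ((1 - weight e) * (x (fst e) - x (snd e))\<^sup>2)
    + 2 * \<epsilon> * (\<pi> (snd e) * weight e * (x (snd e) * s (snd e)))
    + 2 * \<epsilon> * (\<pi> (snd e) * weight e * (weight e * (x (fst e) - x (snd e)) * s (snd e)))
    + \<epsilon>\<^sup>2 * (\<pi> (snd e) * weight e * (weight e * (s (snd e))\<^sup>2))"
  unfolding state_energy_def new_state_def increment_def
    sum_fun_upd[OF E_less(2)[OF e], of "\<lambda>a t. \<pi> a * t\<^sup>2"]
  by (simp add: power2_eq_square algebra_simps)

text \<open>In the first-order term the receiver's state is split into the mean and a deviation.
  Zero total makes the mean a negative multiple of the total surplus, so
  \<open>total_times_inflow_ge\<close> yields the dissipation of \<open>mass\<close>; the deviation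
  is controlled by the disagreement.\<close>

lemma state_energy_drift:
  assumes sc: "strongly_connected n E" and \<pi>: "\<And>i. i < n \<Longrightarrow> \<pi> i > 0"
    and stat: "\<And>f. (\<Sum>e\<in>E. \<pi> (snd e) * (prob_edge e * weight e) * (f (fst e) - f (snd e))) = 0"
  obtains \<eta> \<kappa> C where "\<eta> > 0" "\<kappa> > 0" "C \<ge> 0"
    and "\<And>\<epsilon> x s. 0 \<le> \<epsilon> \<Longrightarrow> (\<Sum>a<n. x a) + (\<Sum>a<n. s a) = 0 \<Longrightarrow>
      (\<Sum>e\<in>E. prob_edge e * state_energy \<pi> (new_state \<epsilon> e x s))
      \<le> state_energy \<pi> x - \<eta> * (disagreement x)\<^sup>2 - \<epsilon> * \<kappa> * (mass s)\<^sup>2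
        + C * \<epsilon> * ((mass s)\<^sup>2 - (\<Sum>a<n. s a)\<^sup>2)
        + C * \<epsilon> * (disagreement x * mass s) + C * \<epsilon>\<^sup>2 * (mass s)\<^sup>2"
proof -
  define K where "K e = \<pi> (snd e) * (prob_edge e * weight e)" for e
  have K: "K e > 0" if "e \<in> E" for e
    unfolding K_def using that \<pi> E_less p_pos w_pos by simp
  have E_ne: "E \<noteq> {}" using p_sum by auto
  define \<eta> where "\<eta> = Min ((\<lambda>e. K e * (1 - weight e)) ` E)"
  have \<eta>: "\<eta> > 0" "\<And>e. e \<in> E \<Longrightarrow> \<eta> \<le> K e * (1 - weight e)"
    using K w_less finite_E E_ne by (auto simp: \<eta>_def)
  obtain g where g: "g > 0" "\<And>s. (\<Sum>a<n. s a) * (\<Sum>e\<in>E. K e * s (snd e))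
      \<ge> g * (mass s)\<^sup>2 - (\<Sum>e\<in>E. K e) * ((mass s)\<^sup>2 - (\<Sum>a<n. s a)\<^sup>2)"
    using total_times_inflow_ge[of K, OF K sc] by blast
  define k where "k = (\<Sum>e\<in>E. K e)"
  have k: "k \<ge> 0" unfolding k_def using K by (intro sum_nonneg) (auto simp: less_imp_le)
  \<comment> \<open>The mixed terms \<open>t3\<close> and \<open>t4\<close> together carry exactly
    this factor; it also dominates the coefficient of the sign defect and that of the second-order
    term.\<close>
  define C where "C = 2 * k * (real (card E) + 1)"
  have C: "C \<ge> 0" "k \<le> C" "2 * k / n \<le> C"
  proof -
    have "k * 1 \<le> k * (real (card E) + 1)" using k by (intro mult_left_mono) auto
    moreover have "2 * k / n \<le> 2 * k / 1" using k n_gt_1 by (intro divide_left_mono) auto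
    ultimately show "C \<ge> 0" "k \<le> C" "2 * k / n \<le> C" using k by (auto simp: C_def)
  qed
  show thesis
  proof (rule that[of \<eta> "2 * g / n" C])
    show "\<eta> > 0" "2 * g / n > 0" "C \<ge> 0" using \<eta>(1) g(1) n_gt_1 C by auto
    fix \<epsilon> :: real and x s :: "nat \<Rightarrow> real"
    assume \<epsilon>: "0 \<le> \<epsilon>" and zero: "(\<Sum>a<n. x a) + (\<Sum>a<n. s a) = 0"
    define N D S where "N = mass s" and "D = disagreement x" and "S = (\<Sum>a<n. s a)"
    define R where "R = N\<^sup>2 - S\<^sup>2"
    have ND: "0 \<le> N" "0 \<le> D" by (simp_all add: N_def D_def mass_nonneg disagreement_nonneg)
    have R: "0 \<le> R"
      unfolding R_def N_def S_def mass_def opposition_sum_sum[symmetric]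
      by (intro sum_nonneg opposition_nonneg)
    define m where "m = (\<Sum>a<n. x a) / n"
    have "(\<Sum>a<n. x a) = - S" unfolding S_def using zero by linarith
    then have m: "m = - S / n" by (simp add: m_def)
    have K_weighted: "(\<Sum>e\<in>E. K e * f e) \<le> k * c" if "\<And>e. e \<in> E \<Longrightarrow> f e \<le> c" for f c
      unfolding k_def sum_distrib_right using that K
      by (intro sum_mono mult_left_mono) (auto simp: less_imp_le)
    have w1: "0 \<le> weight e \<and> weight e \<le> 1" if "e \<in> E" for e
      using w_pos[OF that] w_less[OF that] by simp
    have s_le: "\<bar>s (snd e)\<bar> \<le> N" if "e \<in> E" for e
      unfolding N_def using abs_le_mass E_less that by simp
    have expand: "prob_edge e * state_energy \<pi> (new_state \<epsilon> e x s) = prob_edge e * state_energy \<pi> x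
      + \<pi> (snd e) * (prob_edge e * weight e) * ((x (fst e))\<^sup>2 - (x (snd e))\<^sup>2)
      - K e * (1 - weight e) * (x (fst e) - x (snd e))\<^sup>2
      + 2 * \<epsilon> * (m * (K e * s (snd e)))
      + 2 * \<epsilon> * (K e * ((x (snd e) - m) * s (snd e)))
      + 2 * \<epsilon> * (K e * (weight e * (x (fst e) - x (snd e)) * s (snd e)))
      + \<epsilon>\<^sup>2 * (K e * (weight e * (s (snd e))\<^sup>2))" if "e \<in> E" for e
      unfolding state_energy_new_state[OF that] K_def by (simp add: algebra_simps)
    have t1: "(\<Sum>e\<in>E. K e * (1 - weight e) * (x (fst e) - x (snd e))\<^sup>2) \<ge> \<eta> * D\<^sup>2"
      unfolding D_def disagreement_sq sum_distrib_left
      using \<eta>(2) by (intro sum_mono mult_right_mono) auto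
    have t2: "m * (\<Sum>e\<in>E. K e * s (snd e)) \<le> - (g / n) * N\<^sup>2 + k / n * R"
    proof -
      have "g * N\<^sup>2 - k * R \<le> S * (\<Sum>e\<in>E. K e * s (snd e))"
        using g(2)[of s] by (simp add: N_def S_def R_def k_def)
      then have "(g * N\<^sup>2 - k * R) / n \<le> S * (\<Sum>e\<in>E. K e * s (snd e)) / n"
        by (rule divide_right_mono) simp
      then show ?thesis by (simp add: m diff_divide_distrib)
    qed
    have t3: "(\<Sum>e\<in>E. K e * ((x (snd e) - m) * s (snd e))) \<le> k * (card E * D * N)"
    proof (rule K_weighted)
      fix e assume e: "e \<in> E"
      have "(x (snd e) - m) * s (snd e) \<le> \<bar>x (snd e) - m\<bar> * \<bar>s (snd e)\<bar>"
        by (metis abs_ge_self abs_mult)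
      also have "\<dots> \<le> card E * D * N"
        using diff_mean_le_disagreement[OF sc E_less(2)[OF e], of x] s_le[OF e] ND
        by (intro mult_mono) (auto simp: m_def D_def)
      finally show "(x (snd e) - m) * s (snd e) \<le> card E * D * N" .
    qed
    have t4: "(\<Sum>e\<in>E. K e * (weight e * (x (fst e) - x (snd e)) * s (snd e))) \<le> k * (1 * D * N)"
    proof (rule K_weighted)
      fix e assume e: "e \<in> E"
      have "weight e * (x (fst e) - x (snd e)) * s (snd e)
        \<le> \<bar>weight e\<bar> * \<bar>x (fst e) - x (snd e)\<bar> * \<bar>s (snd e)\<bar>"
        by (metis abs_ge_self abs_mult)
      also have "\<dots> \<le> 1 * D * N"
        using edge_diff_le_disagreement[OF e, of x] s_le[OF e] ND w1[OF e]
        by (intro mult_mono) (auto simp: D_def)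
      finally show "weight e * (x (fst e) - x (snd e)) * s (snd e) \<le> 1 * D * N" .
    qed
    have t5: "(\<Sum>e\<in>E. K e * (weight e * (s (snd e))\<^sup>2)) \<le> k * (1 * N\<^sup>2)"
    proof (rule K_weighted)
      fix e assume e: "e \<in> E"
      have "(s (snd e))\<^sup>2 \<le> N\<^sup>2" using s_le[OF e] ND by (simp add: abs_le_square_iff[symmetric])
      then show "weight e * (s (snd e))\<^sup>2 \<le> 1 * N\<^sup>2"
        using w1[OF e] by (intro mult_mono) auto
    qed
    \<comment> \<open>The zero is stationarity tested with the squared state.\<close>
    have "(\<Sum>e\<in>E. prob_edge e * state_energy \<pi> (new_state \<epsilon> e x s)) = state_energy \<pi> x
      + 0
      - (\<Sum>e\<in>E. K e * (1 - weight e) * (x (fst e) - x (snd e))\<^sup>2)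
      + 2 * \<epsilon> * (m * (\<Sum>e\<in>E. K e * s (snd e)))
      + 2 * \<epsilon> * (\<Sum>e\<in>E. K e * ((x (snd e) - m) * s (snd e)))
      + 2 * \<epsilon> * (\<Sum>e\<in>E. K e * (weight e * (x (fst e) - x (snd e)) * s (snd e)))
      + \<epsilon>\<^sup>2 * (\<Sum>e\<in>E. K e * (weight e * (s (snd e))\<^sup>2))"
      using stat[of "\<lambda>a. (x a)\<^sup>2"] p_sum
      by (simp only: expand sum.distrib sum_subtractf sum_distrib_left[symmetric]
          sum_distrib_right[symmetric] mult_1_left cong: sum.cong)
    also have "\<dots> \<le> state_energy \<pi> x + 0 - \<eta> * D\<^sup>2
      + 2 * \<epsilon> * (- (g / n) * N\<^sup>2 + k / n * R) + 2 * \<epsilon> * (k * (card E * D * N))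
      + 2 * \<epsilon> * (k * (1 * D * N)) + \<epsilon>\<^sup>2 * (k * (1 * N\<^sup>2))"
      using t1 t2 t3 t4 t5 \<epsilon> by (intro add_mono diff_mono mult_left_mono order_refl) auto
    also have "\<dots> = state_energy \<pi> x - \<eta> * D\<^sup>2 - \<epsilon> * (2 * g / n) * N\<^sup>2
      + (2 * k / n) * (\<epsilon> * R) + C * \<epsilon> * (D * N) + k * (\<epsilon>\<^sup>2 * N\<^sup>2)"
      by (simp add: C_def algebra_simps)
    also have "\<dots> \<le> state_energy \<pi> x - \<eta> * D\<^sup>2 - \<epsilon> * (2 * g / n) * N\<^sup>2
      + C * (\<epsilon> * R) + C * \<epsilon> * (D * N) + C * (\<epsilon>\<^sup>2 * N\<^sup>2)"
      using C \<epsilon> R by (intro add_mono mult_right_mono order_refl) auto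
    finally show "(\<Sum>e\<in>E. prob_edge e * state_energy \<pi> (new_state \<epsilon> e x s))
      \<le> state_energy \<pi> x - \<eta> * (disagreement x)\<^sup>2 - \<epsilon> * (2 * g / n) * (mass s)\<^sup>2
        + C * \<epsilon> * ((mass s)\<^sup>2 - (\<Sum>a<n. s a)\<^sup>2)
        + C * \<epsilon> * (disagreement x * mass s) + C * \<epsilon>\<^sup>2 * (mass s)\<^sup>2"
      by (simp add: N_def D_def R_def S_def mult.assoc)
  qed
qed

section \<open>Combining the two energies\<close>

lemma lyapunov_function_exists:
  assumes sc: "strongly_connected n E"
  obtains \<epsilon>b where "\<epsilon>b > 0"
    and "\<And>\<epsilon>. 0 < \<epsilon> \<Longrightarrow> \<epsilon> < \<epsilon>b \<Longrightarrow> \<exists>V c. c > 0 \<and> (\<forall>x s. 0 \<le> V x s) \<and>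
      (\<forall>x s. (\<Sum>a<n. x a) + (\<Sum>a<n. s a) = 0 \<longrightarrow>
        c * ((disagreement x)\<^sup>2 + (mass s)\<^sup>2)
          + (\<Sum>e\<in>E. prob_edge e * V (new_state \<epsilon> e x s) (new_surplus \<epsilon> e x s)) \<le> V x s)"
proof -
  have n0: "n > 0" using n_gt_1 by simp
  have q: "prob_edge e * weight e > 0" if "e \<in> E" for e using p_pos w_pos that by simp
  obtain \<pi> where \<pi>: "\<And>i. i < n \<Longrightarrow> \<pi> i > 0"
    and stat: "\<And>f. (\<Sum>e\<in>E. \<pi> (snd e) * (prob_edge e * weight e) * (f (fst e) - f (snd e))) = 0"
    using stationary_weights_exist[of E n "\<lambda>e. prob_edge e * weight e", OF E_sub n0 q sc] by blast
  obtain h H where h: "\<And>a b. 0 \<le> h a b" "\<And>a b. h a b \<le> H"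
    and coal: "\<And>a b. a < n \<Longrightarrow> b < n \<Longrightarrow> a \<noteq> b \<Longrightarrow>
      (\<Sum>e\<in>E. prob_edge e * h (move_token e a) (move_token e b)) \<le> h a b - 1"
    using coalescence_potential_exists[of E n "\<lambda>e. prob_edge e", OF E_sub n0 p_pos p_sum sc] by blast
  obtain \<eta> \<kappa> C where pos: "\<eta> > 0" "\<kappa> > 0" "C \<ge> 0"
    and drift: "\<And>\<epsilon> x s. 0 \<le> \<epsilon> \<Longrightarrow> (\<Sum>a<n. x a) + (\<Sum>a<n. s a) = 0 \<Longrightarrow>
      (\<Sum>e\<in>E. prob_edge e * state_energy \<pi> (new_state \<epsilon> e x s))
      \<le> state_energy \<pi> x - \<eta> * (disagreement x)\<^sup>2 - \<epsilon> * \<kappa> * (mass s)\<^sup>2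
        + C * \<epsilon> * ((mass s)\<^sup>2 - (\<Sum>a<n. s a)\<^sup>2)
        + C * \<epsilon> * (disagreement x * mass s) + C * \<epsilon>\<^sup>2 * (mass s)\<^sup>2"
    using state_energy_drift[OF sc \<pi> stat] by blast
  have H: "0 \<le> H" using h[of 0 0] by simp
  \<comment> \<open>Total coefficient, up to \<epsilon>, of the mixed term: \<open>C\<close> from
    the state energy and \<open>C * (4 * H)\<close> from the weighted pair energy. The same number
    bounds the second-order term.\<close>
  define B where "B = C + C * (4 * H)"
  have B: "0 \<le> B" using pos H by (simp add: B_def)
  \<comment> \<open>The first bound lets the dissipation of disagreement absorb its share of the
    mixed term, the second lets that of mass absorb the second-order term. Adding 1 keeps the
    denominators positive when \<open>B\<close> is zero.\<close>
  define \<epsilon>b where "\<epsilon>b = min (\<eta> * \<kappa> / (2 * (B\<^sup>2 + 1))) (\<kappa> / (4 * (B + 1)))"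
  have "B\<^sup>2 + 1 > 0" by (simp add: add_nonneg_pos)
  then have "\<epsilon>b > 0" using pos B by (simp add: \<epsilon>b_def)
  then show thesis
  proof (rule that)
    fix \<epsilon> :: real assume \<epsilon>: "0 < \<epsilon>" "\<epsilon> < \<epsilon>b"
    have "\<epsilon> * (2 * (B\<^sup>2 + 1)) < \<eta> * \<kappa>" "\<epsilon> * (4 * (B + 1)) < \<kappa>"
      using \<epsilon>(2) B \<open>B\<^sup>2 + 1 > 0\<close> by (auto simp: \<epsilon>b_def pos_less_divide_eq)
    then have eB2: "\<epsilon> * (B\<^sup>2 / \<kappa>) \<le> \<eta> / 2" and eB: "\<epsilon> * B \<le> \<kappa> / 4"
      using \<epsilon>(1) pos by (auto simp: field_simps)
    \<comment> \<open>With the weight \<open>C * \<epsilon>\<close> the opposition removed from the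
      pair energy cancels the sign defect in the state drift exactly.\<close>
    define V where "V x s = state_energy \<pi> x + C * \<epsilon> * pair_energy h s" for x s
    define c where "c = min (\<eta> / 2) (\<epsilon> * \<kappa> / 2)"
    have V0: "0 \<le> V x s" for x s
      unfolding V_def state_energy_def pair_energy_def using pos \<epsilon> \<pi> h opposition_nonneg
      by (intro add_nonneg_nonneg mult_nonneg_nonneg sum_nonneg) (auto simp: less_imp_le)
    have "c * ((disagreement x)\<^sup>2 + (mass s)\<^sup>2)
          + (\<Sum>e\<in>E. prob_edge e * V (new_state \<epsilon> e x s) (new_surplus \<epsilon> e x s)) \<le> V x s"
      if zero: "(\<Sum>a<n. x a) + (\<Sum>a<n. s a) = 0" for x s
    proof -
      define N D R where "N = mass s" and "D = disagreement x" and "R = (mass s)\<^sup>2 - (\<Sum>a<n. s a)\<^sup>2"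
      have "(\<Sum>e\<in>E. prob_edge e * V (new_state \<epsilon> e x s) (new_surplus \<epsilon> e x s))
        = (\<Sum>e\<in>E. prob_edge e * state_energy \<pi> (new_state \<epsilon> e x s))
          + C * \<epsilon> * (\<Sum>e\<in>E. prob_edge e * pair_energy h (new_surplus \<epsilon> e x s))"
        by (simp add: V_def algebra_simps sum.distrib sum_distrib_left)
      also have "\<dots> \<le> (state_energy \<pi> x - \<eta> * D\<^sup>2 - \<epsilon> * \<kappa> * N\<^sup>2 + C * \<epsilon> * R
          + C * \<epsilon> * (D * N) + C * \<epsilon>\<^sup>2 * N\<^sup>2)
        + C * \<epsilon> * (pair_energy h s - R + 4 * H * (D * N + \<epsilon> * N\<^sup>2))"
        using drift[OF _ zero, of \<epsilon>] pair_energy_drift[of h H \<epsilon> x s, OF h coal] \<epsilon> pos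
        unfolding N_def D_def R_def by (intro add_mono mult_left_mono) auto
      also have "\<dots> = V x s - \<eta> * D\<^sup>2 - \<epsilon> * \<kappa> * N\<^sup>2 + \<epsilon> * (B * (D * N)) + \<epsilon> * ((\<epsilon> * B) * N\<^sup>2)"
        by (simp add: V_def B_def algebra_simps power2_eq_square)
      also have "\<dots> \<le> V x s - \<eta> * D\<^sup>2 - \<epsilon> * \<kappa> * N\<^sup>2 + \<epsilon> * (\<kappa> / 4 * N\<^sup>2 + B\<^sup>2 / \<kappa> * D\<^sup>2)
          + \<epsilon> * (\<kappa> / 4 * N\<^sup>2)"
      proof -
        \<comment> \<open>Young's inequality by completing the square. The mixed and the
          second-order term each use a quarter of the mass dissipation, which leaves half.\<close>
        have "0 \<le> (\<kappa> * N - 2 * B * D)\<^sup>2 / (4 * \<kappa>)" using pos by simp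
        also have "\<dots> = \<kappa> / 4 * N\<^sup>2 + B\<^sup>2 / \<kappa> * D\<^sup>2 - B * (D * N)"
          using pos by (simp add: field_simps power2_eq_square)
        finally have "B * (D * N) \<le> \<kappa> / 4 * N\<^sup>2 + B\<^sup>2 / \<kappa> * D\<^sup>2" by simp
        then show ?thesis
          using eB \<epsilon> by (intro add_mono mult_left_mono mult_right_mono order_refl) auto
      qed
      also have "\<dots> = V x s - \<eta> * D\<^sup>2 + \<epsilon> * (B\<^sup>2 / \<kappa>) * D\<^sup>2 - \<epsilon> * \<kappa> / 2 * N\<^sup>2"
        by (simp add: algebra_simps)
      also have "\<dots> \<le> V x s - \<eta> * D\<^sup>2 + \<eta> / 2 * D\<^sup>2 - \<epsilon> * \<kappa> / 2 * N\<^sup>2"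
        using eB2 by (intro diff_mono add_mono mult_right_mono order_refl) auto
      also have "\<dots> = V x s - (\<eta> / 2 * D\<^sup>2 + \<epsilon> * \<kappa> / 2 * N\<^sup>2)"
        by (simp add: algebra_simps)
      also have "\<dots> \<le> V x s - (c * D\<^sup>2 + c * N\<^sup>2)"
        by (intro diff_mono add_mono mult_right_mono order_refl) (auto simp: c_def)
      finally show ?thesis by (simp add: N_def D_def algebra_simps)
    qed
    moreover have "c > 0" using \<epsilon> pos by (simp add: c_def)
    ultimately show "\<exists>V c. c > 0 \<and> (\<forall>x s. 0 \<le> V x s) \<and>
      (\<forall>x s. (\<Sum>a<n. x a) + (\<Sum>a<n. s a) = 0 \<longrightarrow>
        c * ((disagreement x)\<^sup>2 + (mass s)\<^sup>2)
          + (\<Sum>e\<in>E. prob_edge e * V (new_state \<epsilon> e x s) (new_surplus \<epsilon> e x s)) \<le> V x s)"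
      using V0 by blast
  qed
qed

section \<open>From the drift to almost sure consensus\<close>

lemma pmf_edge_pmf: "pmf (edge_pmf E p) e = (if e \<in> E then prob_edge e else 0)"
proof -
  let ?f = "\<lambda>(j, i). if (j, i) \<in> E then p i j else 0"
  have nonneg: "0 \<le> ?f e" for e using p_pos[of e] by (auto simp: split_beta less_imp_le)
  have "(\<integral>\<^sup>+e. ennreal (?f e) \<partial>count_space UNIV) = (\<Sum>e\<in>E. ennreal (?f e))"
    using finite_E by (intro nn_integral_count_space') (auto simp: split_beta)
  also have "\<dots> = ennreal (\<Sum>e\<in>E. ?f e)" using nonneg by (intro sum_ennreal) auto
  also have "(\<Sum>e\<in>E. ?f e) = 1" using p_sum by (simp add: split_beta cong: sum.cong)
  finally have "(\<integral>\<^sup>+e. ennreal (?f e) \<partial>count_space UNIV) = 1" by simp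
  then show ?thesis
    unfolding edge_pmf_def using nonneg by (subst pmf_embed_pmf) (auto simp: split_beta)
qed

lemma set_edge_pmf: "set_pmf (edge_pmf E p) = E"
proof (rule Set.set_eqI)
  show "e \<in> set_pmf (edge_pmf E p) \<longleftrightarrow> e \<in> E" for e
    using p_pos[of e] by (cases "e \<in> E") (auto simp: set_pmf_iff pmf_edge_pmf)
qed

lemma AE_edges: "AE \<omega> in stream_space (measure_pmf (edge_pmf E p)). \<forall>k. \<omega> !! k \<in> E"
proof -
  have "AE \<omega> in stream_space (measure_pmf (edge_pmf E p)). stream_all (\<lambda>e. e \<in> E) \<omega>"
    by (rule prob_space.AE_stream_all[OF measure_pmf.prob_space_axioms])
      (auto simp: AE_measure_pmf_iff set_edge_pmf)
  then show ?thesis by (simp add: sset_range)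
qed

lemma gossip_traj_eq_iterate_stream:
  "gossip_traj w \<epsilon> x0 \<omega> k = iterate_stream (gossip_step w \<epsilon>) (x0, \<lambda>_. 0) \<omega> k"
  by (induction k) simp_all

text \<open>Transport only relocates surplus, and the increment added to the state is taken from the
  surplus of the same node.\<close>

lemma total_conserved:
  assumes e: "e \<in> E"
  shows "(\<Sum>a<n. new_state \<epsilon> e x s a) + (\<Sum>a<n. new_surplus \<epsilon> e x s a) = (\<Sum>a<n. x a) + (\<Sum>a<n. s a)"
proof -
  have "(\<Sum>a<n. transport e s a) = (\<Sum>c<n. \<Sum>a\<in>{a\<in>{..<n}. move_token e a = c}. s a)"
    by (intro sum.cong) (simp_all add: transport_eq_sum[OF e])
  also have "\<dots> = (\<Sum>a<n. s a)" using move_token_less[OF e] by (intro sum.group) auto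
  finally show ?thesis
    using sum_fun_upd[OF E_less(2)[OF e], of "\<lambda>a t. t" x] sum_fun_upd[OF E_less(2)[OF e], of "\<lambda>a t. t" "transport e s"]
    by (simp add: new_state_def new_surplus_def)
qed

text \<open>This and the next three lemmas allow the states to be centred, which brings the
  conserved total to zero as the drift demands.\<close>

lemma increment_shift: "increment \<epsilon> e (\<lambda>a. x a - c) s = increment \<epsilon> e x s"
  by (simp add: increment_def)

lemma new_state_shift: "new_state \<epsilon> e (\<lambda>a. x a - c) s = (\<lambda>a. new_state \<epsilon> e x s a - c)"
  by (auto simp: new_state_def increment_shift fun_eq_iff)

lemma new_surplus_shift: "new_surplus \<epsilon> e (\<lambda>a. x a - c) s = new_surplus \<epsilon> e x s"
  by (simp add: new_surplus_def increment_shift)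

lemma disagreement_shift: "disagreement (\<lambda>a. x a - c) = disagreement x"
  by (simp add: disagreement_def)

lemma as_average_consensus_if_lyapunov:
  assumes sc: "strongly_connected n E" and c: "c > 0" and V: "\<And>x s. 0 \<le> V x s"
    and drift: "\<And>x s. (\<Sum>a<n. x a) + (\<Sum>a<n. s a) = 0 \<Longrightarrow>
        c * ((disagreement x)\<^sup>2 + (mass s)\<^sup>2)
          + (\<Sum>e\<in>E. prob_edge e * V (new_state \<epsilon> e x s) (new_surplus \<epsilon> e x s)) \<le> V x s"
  shows "as_average_consensus n E p w \<epsilon>"
  unfolding as_average_consensus_def gossip_traj_eq_iterate_stream
proof
  fix x0 :: "nat \<Rightarrow> real"
  let ?P = "edge_pmf E p"
  define xa where "xa = (\<Sum>l<n. x0 l) / real n"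
  define W where "W = (\<lambda>(x, s). c * ((disagreement x)\<^sup>2 + (mass s)\<^sup>2))"
  \<comment> \<open>Centring at the target average gives every point of \<open>I\<close> total
    zero.\<close>
  define U where "U = (\<lambda>(x, s). V (\<lambda>a. x a - xa) s)"
  define I :: "((nat \<Rightarrow> real) \<times> (nat \<Rightarrow> real)) set"
    where "I = {(x, s). (\<Sum>a<n. x a) + (\<Sum>a<n. s a) = (\<Sum>l<n. x0 l)}"
  let ?z = "(x0, \<lambda>_. 0) :: (nat \<Rightarrow> real) \<times> (nat \<Rightarrow> real)"
  have W0: "0 \<le> W z" for z using c by (auto simp: W_def split_beta)
  have I_step: "gossip_step w \<epsilon> e z \<in> I" if "e \<in> E" "z \<in> I" for e z
    using that total_conserved by (cases z) (auto simp: I_def gossip_step_eq)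
  have z: "?z \<in> I" by (simp add: I_def)
  have "AE \<omega> in stream_space (measure_pmf ?P).
    (\<lambda>k. W (iterate_stream (gossip_step w \<epsilon>) ?z \<omega> k)) \<longlonglongrightarrow> 0"
  proof (rule AE_iterate_stream_tendsto_0[where I = I and V = U])
    fix z assume "z \<in> I"
    obtain x s where zxs: "z = (x, s)" by force
    have U0: "0 \<le> U z" for z using V by (simp add: U_def split_beta)
    have "(\<Sum>a<n. x a - xa) + (\<Sum>a<n. s a) = 0"
      using \<open>z \<in> I\<close> n_gt_1 by (simp add: I_def zxs sum_subtractf xa_def)
    from drift[OF this] have "W z + (\<Sum>e\<in>E. prob_edge e * U (gossip_step w \<epsilon> e z)) \<le> U z"
      by (simp add: W_def U_def zxs gossip_step_eq new_state_shift new_surplus_shift disagreement_shift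
          cong: sum.cong)
    then have "ennreal (W z + (\<Sum>e\<in>E. prob_edge e * U (gossip_step w \<epsilon> e z))) \<le> ennreal (U z)"
      by (rule ennreal_leI)
    moreover have "(\<integral>\<^sup>+e. ennreal (U (gossip_step w \<epsilon> e z)) \<partial>measure_pmf ?P)
      = ennreal (\<Sum>e\<in>E. prob_edge e * U (gossip_step w \<epsilon> e z))"
    proof -
      have "(\<integral>\<^sup>+e. ennreal (U (gossip_step w \<epsilon> e z)) \<partial>measure_pmf ?P)
        = (\<Sum>e\<in>E. ennreal (U (gossip_step w \<epsilon> e z)) * ennreal (pmf ?P e))"
        using finite_E by (subst nn_integral_measure_pmf_finite) (auto simp: set_edge_pmf)
      also have "\<dots> = (\<Sum>e\<in>E. ennreal (prob_edge e * U (gossip_step w \<epsilon> e z)))"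
        using p_pos U0 by (intro sum.cong) (auto simp: pmf_edge_pmf ennreal_mult' mult.commute less_imp_le)
      also have "\<dots> = ennreal (\<Sum>e\<in>E. prob_edge e * U (gossip_step w \<epsilon> e z))"
        using p_pos U0 by (intro sum_ennreal) (auto simp: less_imp_le)
      finally show ?thesis .
    qed
    moreover have "0 \<le> (\<Sum>e\<in>E. prob_edge e * U (gossip_step w \<epsilon> e z))"
      using p_pos U0 by (intro sum_nonneg mult_nonneg_nonneg) (auto simp: less_imp_le)
    ultimately show "ennreal (W z) + (\<integral>\<^sup>+e. ennreal (U (gossip_step w \<epsilon> e z)) \<partial>measure_pmf ?P)
      \<le> ennreal (U z)"
      using W0[of z] by (simp add: ennreal_plus)
  qed (use W0 I_step z in \<open>auto simp: set_edge_pmf\<close>)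
  with AE_edges show "AE \<omega> in stream_space (measure_pmf ?P).
    (\<forall>i<n. (\<lambda>k. fst (iterate_stream (gossip_step w \<epsilon>) ?z \<omega> k) i) \<longlonglongrightarrow> (\<Sum>l<n. x0 l) / real n) \<and>
    (\<forall>i<n. (\<lambda>k. snd (iterate_stream (gossip_step w \<epsilon>) ?z \<omega> k) i) \<longlonglongrightarrow> 0)"
  proof eventually_elim
    case (elim \<omega>)
    define Z where "Z = iterate_stream (gossip_step w \<epsilon>) ?z \<omega>"
    have ZI: "Z k \<in> I" for k
      unfolding Z_def by (induction k) (use elim(1) I_step z in auto)
    define q where "q k = sqrt (W (Z k) / c)" for k
    have "(\<lambda>k. sqrt (W (Z k) / c)) \<longlonglongrightarrow> sqrt (0 / c)"
      using elim(2) c unfolding Z_def by (intro tendsto_intros) auto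
    then have q: "q \<longlonglongrightarrow> 0" by (simp add: q_def[abs_def])
    have le_q: "disagreement (fst (Z k)) \<le> q k" "mass (snd (Z k)) \<le> q k" for k
      using c by (auto simp: q_def W_def split_beta intro!: real_le_rsqrt)
    have s: "(\<lambda>k. snd (Z k) i) \<longlonglongrightarrow> 0" if "i < n" for i
    proof (rule Lim_null_comparison[OF always_eventually q], rule allI)
      fix k
      show "norm (snd (Z k) i) \<le> q k" using abs_le_mass[OF that, of "snd (Z k)"] le_q(2)[of k] by simp
    qed
    \<comment> \<open>The error splits into the deviation from the current mean, bounded by the
      disagreement, and the distance of that mean from \<open>xa\<close>, which by conservation is
      the absolute total surplus over \<open>n\<close>.\<close>
    have x: "(\<lambda>k. fst (Z k) i - xa) \<longlonglongrightarrow> 0" if i: "i < n" for i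
    proof (rule Lim_null_comparison[OF always_eventually], rule allI)
      fix k
      define x s where "x = fst (Z k)" and "s = snd (Z k)"
      have "(\<Sum>a<n. x a) + (\<Sum>a<n. s a) = n * xa"
        using ZI[of k] n_gt_1 by (auto simp: I_def x_def s_def xa_def split_beta)
      then have "(\<Sum>a<n. x a) = n * xa - (\<Sum>a<n. s a)" by linarith
      then have "(\<Sum>a<n. x a) / n - xa = - (\<Sum>a<n. s a) / n"
        using n_gt_1 by (simp add: diff_divide_distrib)
      then have "\<bar>(\<Sum>a<n. x a) / n - xa\<bar> = \<bar>\<Sum>a<n. s a\<bar> / n" by simp
      also have "\<dots> \<le> mass s / n"
        unfolding mass_def by (intro divide_right_mono sum_abs) simp
      also have "\<dots> \<le> mass s / 1"
        using n_gt_1 mass_nonneg by (intro divide_left_mono) auto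
      finally have "\<bar>(\<Sum>a<n. x a) / n - xa\<bar> \<le> q k" using le_q(2)[of k] by (simp add: s_def)
      moreover have "\<bar>x i - (\<Sum>a<n. x a) / n\<bar> \<le> card E * q k"
        using diff_mean_le_disagreement[OF sc i, of x] mult_left_mono[OF le_q(1)[of k], of "card E"]
        by (simp add: x_def)
      ultimately show "norm (fst (Z k) i - xa) \<le> card E * q k + q k"
        unfolding x_def[symmetric] real_norm_def by linarith
    next
      show "(\<lambda>k. card E * q k + q k) \<longlonglongrightarrow> 0"
        using tendsto_add[OF tendsto_mult_left[OF q, of "real (card E)"] q] by simp
    qed
    show ?case using s x unfolding Z_def xa_def by (simp add: LIM_zero_iff)
  qed
qed

section \<open>Necessity of strong connectivity\<close>

lemma strongly_connected_if_consensus: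
  assumes cons: "as_average_consensus n E p w \<epsilon>"
  shows "strongly_connected n E"
proof (rule ccontr)
  assume "\<not> strongly_connected n E"
  then obtain i j where ij: "i < n" "j < n" "(i, j) \<notin> E\<^sup>*" by (auto simp: strongly_connected_def)
  define x0 :: "nat \<Rightarrow> real" where "x0 a = of_bool ((i, a) \<in> E\<^sup>*)" for a
  let ?S = "stream_space (measure_pmf (edge_pmf E p))"
  interpret S: prob_space ?S
    by (rule prob_space.prob_space_stream_space) (rule measure_pmf.prob_space_axioms)
  have inv: "fst (gossip_traj w \<epsilon> x0 \<omega> k) a = 0 \<and> snd (gossip_traj w \<epsilon> x0 \<omega> k) a = 0"
    if \<omega>: "\<forall>k. \<omega> !! k \<in> E" and "(i, a) \<notin> E\<^sup>*" for \<omega> k a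
    using that(2)
  proof (induction k arbitrary: a)
    case 0
    then show ?case by (simp add: x0_def)
  next
    case (Suc k)
    obtain x s where xs: "gossip_traj w \<epsilon> x0 \<omega> k = (x, s)" by force
    have IH: "x a = 0" "s a = 0" if "(i, a) \<notin> E\<^sup>*" for a using Suc.IH[OF that] by (simp_all add: xs)
    have e: "\<omega> !! k \<in> E" using \<omega> by simp
    \<comment> \<open>A receiver unreachable from \<open>i\<close> has an unreachable sender, so by
      induction it receives only zero state and zero surplus.\<close>
    have "(i, fst (\<omega> !! k)) \<notin> E\<^sup>*" if "(i, snd (\<omega> !! k)) \<notin> E\<^sup>*"
      using that e by (metis prod.collapse rtrancl.rtrancl_into_rtrancl)
    then show ?case
      using Suc.prems IH
      by (auto simp: xs gossip_step_eq[OF e] new_state_def new_surplus_def increment_def transport_def)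
  qed
  have "0 < (\<Sum>l<n. x0 l)"
    using ij(1) by (intro sum_pos2[of _ i]) (auto simp: x0_def)
  then have pos: "0 < (\<Sum>l<n. x0 l) / real n" using n_gt_1 by simp
  from cons have "AE \<omega> in ?S. (\<lambda>k. fst (gossip_traj w \<epsilon> x0 \<omega> k) j) \<longlonglongrightarrow> (\<Sum>l<n. x0 l) / real n"
    using ij(2) unfolding as_average_consensus_def by (auto dest!: spec[of _ x0] elim: AE_mp)
  with AE_edges have "AE \<omega> in ?S. False"
  proof eventually_elim
    case (elim \<omega>)
    then have "(\<lambda>k. 0 :: real) \<longlonglongrightarrow> (\<Sum>l<n. x0 l) / real n" using inv[OF elim(1) ij(3)] by simp
    then show False using pos LIMSEQ_unique[OF tendsto_const] by fastforce
  qed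
  then show False by simp
qed

end

theorem corollary1:
  fixes n :: nat and E :: "(nat \<times> nat) set" and p w :: "nat \<Rightarrow> nat \<Rightarrow> real"
  assumes "n > 1"
    and "E \<subseteq> {..<n} \<times> {..<n}"
    and "\<forall>(j, i)\<in>E. j \<noteq> i"
    and "\<forall>(j, i)\<in>E. 0 < p i j \<and> p i j < 1"
    and "(\<Sum>(j, i)\<in>E. p i j) = 1"
    and "\<forall>(j, i)\<in>E. 0 < w i j \<and> w i j < 1"
  shows "strongly_connected n E \<longleftrightarrow>
    (\<exists>\<epsilon>b > 0. \<forall>\<epsilon>. 0 < \<epsilon> \<and> \<epsilon> < \<epsilon>b \<longrightarrow> as_average_consensus n E p w \<epsilon>)"
proof -
  interpret gossip_network n E p w
    using assms by unfold_locales (auto simp: split_beta)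
  show ?thesis
  proof
    assume sc: "strongly_connected n E"
    obtain \<epsilon>b where "\<epsilon>b > 0"
      and lyap: "\<And>\<epsilon>. 0 < \<epsilon> \<Longrightarrow> \<epsilon> < \<epsilon>b \<Longrightarrow> \<exists>V c. c > 0 \<and> (\<forall>x s. 0 \<le> V x s) \<and>
      (\<forall>x s. (\<Sum>a<n. x a) + (\<Sum>a<n. s a) = 0 \<longrightarrow>
        c * ((disagreement x)\<^sup>2 + (mass s)\<^sup>2)
          + (\<Sum>e\<in>E. prob_edge e * V (new_state \<epsilon> e x s) (new_surplus \<epsilon> e x s)) \<le> V x s)"
      using lyapunov_function_exists[OF sc] by blast
    moreover have "as_average_consensus n E p w \<epsilon>" if \<epsilon>: "0 < \<epsilon> \<and> \<epsilon> < \<epsilon>b" for \<epsilon>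
    proof -
      from lyap \<epsilon> obtain V c where "c > 0" "\<And>x s. 0 \<le> V x s"
        "\<And>x s. (\<Sum>a<n. x a) + (\<Sum>a<n. s a) = 0 \<Longrightarrow>
          c * ((disagreement x)\<^sup>2 + (mass s)\<^sup>2)
            + (\<Sum>e\<in>E. prob_edge e * V (new_state \<epsilon> e x s) (new_surplus \<epsilon> e x s)) \<le> V x s"
        by blast
      with sc show ?thesis by (rule as_average_consensus_if_lyapunov)
    qed
    ultimately show "\<exists>\<epsilon>b > 0. \<forall>\<epsilon>. 0 < \<epsilon> \<and> \<epsilon> < \<epsilon>b \<longrightarrow> as_average_consensus n E p w \<epsilon>" by blast
  next
    assume "\<exists>\<epsilon>b > 0. \<forall>\<epsilon>. 0 < \<epsilon> \<and> \<epsilon> < \<epsilon>b \<longrightarrow> as_average_consensus n E p w \<epsilon>"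
    then obtain \<epsilon>b where "\<epsilon>b > 0" "\<forall>\<epsilon>. 0 < \<epsilon> \<and> \<epsilon> < \<epsilon>b \<longrightarrow> as_average_consensus n E p w \<epsilon>" by blast
    \<comment> \<open>One admissible parameter is enough for the converse.\<close>
    then have "as_average_consensus n E p w (\<epsilon>b / 2)" by simp
    then show "strongly_connected n E" by (rule strongly_connected_if_consensus)
  qed
qed

end
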